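(* There is an absolute constant $C>0$ such that the following holds. In the setting described in the context (convex case $\mu=0$), let $T\ge 1$ be a (known) integer, $\delta\in(0,1)$, $M\ge 0$ and $\beta>0$ be real numbers, put $\alpha=\frac{\beta}{\log(4/\delta)}$, and run projected SGD with clipping for $T$ steps with $$M_t=\max\{2G,\;M T^{1/p}\},\qquad \eta_t=\min\Big\{\frac{\alpha}{G\sqrt T},\;\frac{\alpha}{M_t}\Big\}\qquad(1\le t\le T).$$ Let $\bar x_T=\frac1T\sum_{t=1}^T x_t$. Then with probability at least $1-\delta$, $$F(\bar x_T)-F(x_* )\le C\left(\beta(\sigma/M)^{2p}+\log(4/\delta)\Big(\beta+\frac{\|x_1-x_*\|^2}{\beta}\Big)\right)\max\left\{\frac{G}{\sqrt T},\;\frac{M}{T^{\frac{p-1}{p}}}\right\}.$$ In particular, with the choice $M=\sigma$, with probability at least $1-\delta$, $$F(\bar x_T)-F(x_* )\le C\log(4/\delta)\Big(\beta+\frac{\|x_1-x_*\|^2}{\beta}\Big)\max\left\{\frac{G}{\sqrt T},\;\frac{\sigma}{T^{\frac{p-1}{p}}}\right\}.$$ The constant $C$ does not depend on $F,\mathcal X,d$, the oracle, $p,G,\sigma,M,\beta,\delta,T,x_1,x_*$.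
   Context: $\|\cdot\|$ is the Euclidean norm on $\mathbb R^d$ and $\log$ is the natural logarithm. Problem. $F$ is a convex function on $\mathbb R^d$ (possibly $+\infty$-valued), $\mathcal X\subseteq \mathrm{int}(\mathrm{dom}(F))\subseteq\mathbb R^d$ is a closed convex set (not assumed bounded), and $\partial F(x)$ is the set of subgradients of $F$ at $x$. Assumptions: (1) there is $x_*\in\arg\min_{x\in\mathcal X}F(x)$ with $F(x_* )>-\infty$; (2) $\mu$-strong convexity with $\mu=0$: $F(x)\ge F(y)+\langle g,x-y\rangle$ for all $x,y\in\mathcal X$, $g\in\partial F(y)$; (3) there is $G>0$ with $\|g\|\le G$ for all $x\in\mathcal X$, $g\in\partial F(x)$; (4) for every $x\in\mathcal X$ one can access a history-independent random vector $\widehat\partial F(x)$ with $\mathbb E[\widehat\partial F(x)\mid x]\in\partial F(x)$; (5) there are $p\in(1,2]$ and $\sigma\ge0$ with $\mathbb E[\|\widehat\partial F(x)-\mathbb E[\widehat\partial F(x)\mid x]\|^p\mid x]\le\sigma^p$. Consequently, with $\mathcal F_t=\sigma(\widehat\partial F(x_1),\dots,\widehat\partial F(x_t))$, the conditional versions of (4), (5) given $\mathcal F_{t-1}$ hold at the iterate $x_t$. Algorithm (projected SGD with clipping). Input $x_1\in\mathcal X$, $M_t>0$, $\eta_t>0$. For $t=1,2,\dots$: $g_t=\min\{1,\,M_t/\|\widehat\partial F(x_t)\|\}\,\widehat\partial F(x_t)$ and $x_{t+1}=\Pi_{\mathcal X}(x_t-\eta_t g_t)$, where $\Pi_{\mathcal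 X}$ is Euclidean projection onto $\mathcal X$ (and $g_t=0$ if $\widehat\partial F(x_t)=0$). Convention: if $M=\sigma=0$, $\sigma/M$ is read as $0$; if $M=0<\sigma$, a bound containing $\sigma/M$ is read as $+\infty$ (vacuous). *)

theory Defs
  imports "HOL-Probability.Probability"
begin

text \<open>
  The dimension \<open>d\<close> has to be quantified below an existential constant that does not depend on it,
  so it cannot be a type. Points of \<open>d\<close>-dimensional space are the sequences vanishing from index
  \<open>d\<close> on, i.e. the points of the library's topological space \<^const>\<open>Euclidean_space\<close>.
\<close>

abbreviation Rd :: "nat \<Rightarrow> (nat \<Rightarrow> real) set" where
  "Rd d \<equiv> topspace (Euclidean_space d)"

abbreviation borel_Rd :: "nat \<Rightarrow> (nat \<Rightarrow> real) measure" where
  "borel_Rd d \<equiv> restrict_space borel (Rd d)"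

definition einner :: "nat \<Rightarrow> (nat \<Rightarrow> real) \<Rightarrow> (nat \<Rightarrow> real) \<Rightarrow> real" where
  "einner d x y = (\<Sum>i<d. x i * y i)"

definition enorm :: "nat \<Rightarrow> (nat \<Rightarrow> real) \<Rightarrow> real" where
  "enorm d x = L2_set x {..<d}"

abbreviation vsub :: "(nat \<Rightarrow> real) \<Rightarrow> (nat \<Rightarrow> real) \<Rightarrow> nat \<Rightarrow> real" where
  "vsub x y \<equiv> (\<lambda>i. x i - y i)"

definition convex_set :: "(nat \<Rightarrow> real) set \<Rightarrow> bool" where
  "convex_set X \<longleftrightarrow>
     (\<forall>x\<in>X. \<forall>y\<in>X. \<forall>u\<ge>0. \<forall>v\<ge>0. u + v = 1 \<longrightarrow> (\<lambda>i. u * x i + v * y i) \<in> X)"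

definition convex_fun :: "nat \<Rightarrow> ((nat \<Rightarrow> real) \<Rightarrow> ereal) \<Rightarrow> bool" where
  "convex_fun d F \<longleftrightarrow>
     (\<forall>x\<in>Rd d. \<forall>y\<in>Rd d. \<forall>u\<ge>0. \<forall>v\<ge>0. u + v = 1 \<longrightarrow>
        F (\<lambda>i. u * x i + v * y i) \<le> ereal u * F x + ereal v * F y)"

definition effective_domain :: "nat \<Rightarrow> ((nat \<Rightarrow> real) \<Rightarrow> ereal) \<Rightarrow> (nat \<Rightarrow> real) set" where
  "effective_domain d F = {x \<in> Rd d. F x < \<infinity>}"

definition subdifferential ::
  "nat \<Rightarrow> ((nat \<Rightarrow> real) \<Rightarrow> ereal) \<Rightarrow> (nat \<Rightarrow> real) \<Rightarrow> (nat \<Rightarrow> real) set" where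
  "subdifferential d F x =
     {g \<in> Rd d. \<forall>y\<in>Rd d. F y \<ge> F x + ereal (einner d g (vsub y x))}"

definition projection :: "nat \<Rightarrow> (nat \<Rightarrow> real) set \<Rightarrow> (nat \<Rightarrow> real) \<Rightarrow> nat \<Rightarrow> real" where
  "projection d X y = arg_min_on (\<lambda>x. enorm d (vsub x y)) X"

definition mean_vec :: "(nat \<Rightarrow> real) measure \<Rightarrow> nat \<Rightarrow> real" where
  "mean_vec \<mu> = (\<lambda>i. \<integral>y. y i \<partial>\<mu>)"

text \<open>
  \<open>Q x\<close> is the law of the oracle's answer at the query point \<open>x\<close>. Being a Markov kernel, it depends
  on the query point only, which is the history independence of the oracle.
\<close>

locale stochastic_convex_problem =
  fixes d :: nat
    and F :: "(nat \<Rightarrow> real) \<Rightarrow> ereal"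
    and X :: "(nat \<Rightarrow> real) set"
    and xs :: "nat \<Rightarrow> real"
    and G p \<sigma> :: real
    and Q :: "(nat \<Rightarrow> real) \<Rightarrow> (nat \<Rightarrow> real) measure"
  assumes F_not_MInf: "\<And>x. x \<in> Rd d \<Longrightarrow> F x \<noteq> - \<infinity>"
    and F_convex: "convex_fun d F"
    and X_closed: "closedin (Euclidean_space d) X"
    and X_convex: "convex_set X"
    and X_interior: "X \<subseteq> Euclidean_space d interior_of effective_domain d F"
    and minimizer: "is_arg_min F (\<lambda>x. x \<in> X) xs"
    and minimum_finite: "F xs > - \<infinity>"
    and first_order: "\<And>x y g. x \<in> X \<Longrightarrow> y \<in> X \<Longrightarrow> g \<in> subdifferential d F y \<Longrightarrow>
          F x \<ge> F y + ereal (einner d g (vsub x y))"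
    and G_pos: "G > 0"
    and G_bound: "\<And>x g. x \<in> X \<Longrightarrow> g \<in> subdifferential d F x \<Longrightarrow> enorm d g \<le> G"
    and oracle_kernel: "Q \<in> restrict_space borel X \<rightarrow>\<^sub>M prob_algebra (borel_Rd d)"
    and oracle_integrable: "\<And>x i. x \<in> X \<Longrightarrow> integrable (Q x) (\<lambda>y. y i)"
    and oracle_unbiased: "\<And>x. x \<in> X \<Longrightarrow> mean_vec (Q x) \<in> subdifferential d F x"
    and p_range: "1 < p" "p \<le> 2"
    and sigma_nonneg: "\<sigma> \<ge> 0"
    and oracle_moment: "\<And>x. x \<in> X \<Longrightarrow>
          (\<integral>\<^sup>+y. ennreal (enorm d (vsub y (mean_vec (Q x))) powr p) \<partial>Q x) \<le> ennreal (\<sigma> powr p)"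

text \<open>For \<open>y = 0\<close> the quotient is \<open>0\<close>, so \<open>clip d m 0 = 0\<close>.\<close>

definition clip :: "nat \<Rightarrow> real \<Rightarrow> (nat \<Rightarrow> real) \<Rightarrow> nat \<Rightarrow> real" where
  "clip d m y = (\<lambda>i. min 1 (m / enorm d y) * y i)"

text \<open>
  \<open>iterate \<dots> x1 \<omega> t\<close> is the iterate \<open>x\<^sub>t\<^sub>+\<^sub>1\<close> of projected SGD with clipping levels \<open>m 1, m 2, \<dots>\<close>
  and step sizes \<open>\<eta> 1, \<eta> 2, \<dots>\<close>, where \<open>\<omega> t\<close> is the oracle's answer at \<open>x\<^sub>t\<^sub>+\<^sub>1\<close>. It depends on
  \<open>\<omega> 0, \<dots>, \<omega> (t - 1)\<close> only.
\<close>

primrec iterate :: "nat \<Rightarrow> (nat \<Rightarrow> real) set \<Rightarrow> (nat \<Rightarrow> real) \<Rightarrow> (nat \<Rightarrow> real) \<Rightarrow> (nat \<Rightarrow> real) \<Rightarrow>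
    (nat \<Rightarrow> nat \<Rightarrow> real) \<Rightarrow> nat \<Rightarrow> nat \<Rightarrow> real" where
  "iterate d X m \<eta> x1 \<omega> 0 = x1"
| "iterate d X m \<eta> x1 \<omega> (Suc t) =
     projection d X
       (vsub (iterate d X m \<eta> x1 \<omega> t) (\<lambda>i. \<eta> (Suc t) * clip d (m (Suc t)) (\<omega> t) i))"

definition average_iterate :: "nat \<Rightarrow> (nat \<Rightarrow> real) set \<Rightarrow> (nat \<Rightarrow> real) \<Rightarrow> (nat \<Rightarrow> real) \<Rightarrow>
    (nat \<Rightarrow> real) \<Rightarrow> nat \<Rightarrow> (nat \<Rightarrow> nat \<Rightarrow> real) \<Rightarrow> nat \<Rightarrow> real" where
  "average_iterate d X m \<eta> x1 T \<omega> = (\<lambda>i. (\<Sum>t<T. iterate d X m \<eta> x1 \<omega> t i) / real T)"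

text \<open>
  The joint law of the oracle's answers at the first \<open>T\<close> iterates, a measure on
  \<open>PiM {0..<T} (\<lambda>_. borel_Rd d)\<close>: the conditional law of answer \<open>t\<close> given the earlier answers is
  the oracle's law at the current iterate. The library's constant builds this law step by step
  with the Giry monad, here from the empty history.
\<close>

definition answers_law :: "nat \<Rightarrow> (nat \<Rightarrow> real) set \<Rightarrow> ((nat \<Rightarrow> real) \<Rightarrow> (nat \<Rightarrow> real) measure) \<Rightarrow>
    (nat \<Rightarrow> real) \<Rightarrow> (nat \<Rightarrow> real) \<Rightarrow> (nat \<Rightarrow> real) \<Rightarrow> nat \<Rightarrow> (nat \<Rightarrow> nat \<Rightarrow> real) measure" where
  "answers_law d X Q m \<eta> x1 T =
     Ionescu_Tulcea.C (\<lambda>t \<omega>. Q (iterate d X m \<eta> x1 \<omega> t)) (\<lambda>_. borel_Rd d) 0 T (\<lambda>_. undefined)"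

end

theory Submission
  imports Defs
begin

text \<open>
  Fix \<open>R\<close>, and let \<open>Z\<^sub>t\<close> be the increment by which one step can raise \<open>\<parallel>x\<^sub>t - x\<^sub>*\<parallel>\<^sup>2 + 2\<eta> \<Sum> (F x\<^sub>i - F x\<^sub>*)\<close>.
  Switch \<open>Z\<^sub>t\<close> off once an iterate has left the ball of radius \<open>R\<close> around \<open>x\<^sub>*\<close>. Inside the ball
  \<open>\<bar>Z\<^sub>t\<bar> \<le> 4\<alpha>R\<close>, and the moment bounds for the clipped gradient give
  \<open>E exp (Z\<^sub>t / (4\<alpha>R)) \<le> exp ((1 + 13s) / T)\<close> with \<open>s = (\<sigma>/M)\<^sup>p\<close>. Hence, by Markov's inequality at time \<open>T\<close>
  alone, the stopped sum is at most \<open>4\<alpha>R(1 + 13s + log (1/\<delta>))\<close> with probability \<open>1 - \<delta>\<close>. For \<open>R\<close> of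
  order \<open>\<parallel>x\<^sub>1 - x\<^sub>*\<parallel> + \<alpha>(s + log (4/\<delta>))\<close> this keeps every iterate in the ball, without a union bound over
  the steps, so nothing was switched off and the regret is at most \<open>R\<^sup>2 / (2\<eta>)\<close>.
\<close>

section \<open>Inner product and norm on the first \<open>d\<close> coordinates\<close>

lemma enorm_nonneg [simp]: "0 \<le> enorm d x"
  by (simp add: enorm_def)

lemma enorm_power2: "(enorm d x)\<^sup>2 = einner d x x"
  by (simp add: enorm_def L2_set_def einner_def sum_nonneg power2_eq_square)

lemma einner_diff_left: "einner d (vsub x y) z = einner d x z - einner d y z"
  by (simp add: einner_def sum_subtractf algebra_simps)

lemma einner_diff_right: "einner d z (vsub x y) = einner d z x - einner d z y"
  by (simp add: einner_def sum_subtractf algebra_simps)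

lemma einner_scale_left: "einner d (\<lambda>i. c * x i) z = c * einner d x z"
  by (simp add: einner_def sum_distrib_left algebra_simps)

lemma einner_scale_right: "einner d z (\<lambda>i. c * x i) = c * einner d z x"
  by (simp add: einner_def sum_distrib_left algebra_simps)

lemma einner_commute: "einner d x y = einner d y x"
  by (simp add: einner_def mult.commute)

lemmas einner_simps = einner_diff_left einner_diff_right einner_scale_left einner_scale_right

lemma einner_Cauchy_Schwarz: "\<bar>einner d x y\<bar> \<le> enorm d x * enorm d y"
proof -
  have "\<bar>einner d x y\<bar> \<le> (\<Sum>i<d. \<bar>x i\<bar> * \<bar>y i\<bar>)"
    unfolding einner_def by (rule order_trans[OF sum_abs]) (simp add: abs_mult)
  also have "\<dots> \<le> enorm d x * enorm d y"
    unfolding enorm_def by (rule L2_set_mult_ineq)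
  finally show ?thesis .
qed

lemma enorm_scale: "enorm d (\<lambda>i. c * x i) = \<bar>c\<bar> * enorm d x"
  by (simp add: enorm_def L2_set_def power_mult_distrib real_sqrt_mult flip: sum_distrib_left)

lemma enorm_diff_commute: "enorm d (vsub x y) = enorm d (vsub y x)"
  by (simp add: enorm_def L2_set_def power2_commute)

lemma enorm_diff_triangle: "enorm d (vsub x z) \<le> enorm d (vsub x y) + enorm d (vsub y z)"
  using L2_set_triangle_ineq[of "vsub x y" "vsub y z" "{..<d}"] by (simp add: enorm_def)

lemma enorm_triangle_sub: "enorm d x \<le> enorm d y + enorm d (vsub x y)"
  using enorm_diff_triangle[of d x "\<lambda>_. 0" y] by simp

lemma enorm_diff_power2:
  "(enorm d (vsub x y))\<^sup>2 = (enorm d x)\<^sup>2 - 2 * einner d x y + (enorm d y)\<^sup>2"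
  by (simp add: enorm_power2 einner_simps einner_commute[of d y x])

lemma abs_component_le_enorm: "i < d \<Longrightarrow> \<bar>x i\<bar> \<le> enorm d x"
  unfolding enorm_def L2_set_def
  by (rule real_le_rsqrt) (auto intro!: member_le_sum)

lemma continuous_on_enorm_diff [continuous_intros]: "continuous_on S (\<lambda>x. enorm d (vsub x y))"
  unfolding enorm_def L2_set_def
  by (intro continuous_intros continuous_on_subset[OF continuous_on_product_coordinates]) auto

text \<open>On sequences \<open>enorm d\<close> is only a seminorm, blind to the coordinates from
  \<open>d\<close> on. It is continuous in the product topology, though, so a Lipschitz bound stated
  with it still forces continuity in that topology.\<close>

lemma continuous_on_if_le_enorm:
  fixes f :: "(nat \<Rightarrow> real) \<Rightarrow> real"
  assumes "\<And>x y. x \<in> S \<Longrightarrow> y \<in> S \<Longrightarrow> \<bar>f y - f x\<bar> \<le> K * enorm d (vsub y x)"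
  shows "continuous_on S f"
  unfolding continuous_on_def
proof
  fix x assume x: "x \<in> S"
  have "continuous_on S (\<lambda>y. K * enorm d (vsub y x))"
    by (intro continuous_intros)
  then have "((\<lambda>y. K * enorm d (vsub y x)) \<longlongrightarrow> K * enorm d (vsub x x)) (at x within S)"
    using x unfolding continuous_on_def by blast
  then have "((\<lambda>y. K * enorm d (vsub y x)) \<longlongrightarrow> 0) (at x within S)"
    by (simp add: enorm_def L2_set_def)
  then have "((\<lambda>y. f y - f x) \<longlongrightarrow> 0) (at x within S)"
    by (rule Lim_null_comparison[rotated]) (auto simp: eventually_at_filter x assms)
  then show "(f \<longlongrightarrow> f x) (at x within S)"
    using LIM_zero_iff by blast
qed

section \<open>Projection onto a closed convex set\<close>

lemma projection_exists:
  assumes "closed X" "X \<subseteq> Rd d" "X \<noteq> {}"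
  obtains z where "is_arg_min (\<lambda>x. enorm d (vsub x y)) (\<lambda>x. x \<in> X) z"
proof -
  obtain x0 where x0: "x0 \<in> X" using assms by auto
  define r where "r = enorm d (vsub x0 y)"
  \<comment> \<open>\<open>X\<close> may be unbounded. The box \<open>B\<close> is compact by
    Tychonoff's theorem and contains every point of \<open>X\<close> that is no farther from
    \<open>y\<close> than \<open>x0\<close>, so a minimizer over \<open>X \<inter> B\<close> is a
    minimizer over \<open>X\<close>.\<close>
  define B where "B = PiE UNIV (\<lambda>i. if i < d then {y i - r..y i + r} else {0})"
  have "compactin (product_topology (\<lambda>_. euclideanreal) UNIV) B"
    unfolding B_def by (subst compactin_PiE) auto
  then have "compact B"
    by (simp add: euclidean_product_topology)
  then have cK: "compact (X \<inter> B)"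
    using assms by (metis compact_Int_closed inf_commute)
  have inB: "x \<in> B" if "x \<in> X" "enorm d (vsub x y) \<le> r" for x
    unfolding B_def
  proof (rule PiE_I)
    fix i :: nat
    show "x i \<in> (if i < d then {y i - r..y i + r} else {0})"
    proof (cases "i < d")
      case True
      then have "\<bar>x i - y i\<bar> \<le> r"
        using abs_component_le_enorm[of i d "vsub x y"] that by simp
      then show ?thesis using True by auto
    next
      case False
      then show ?thesis using that assms by (auto simp: topspace_Euclidean_space)
    qed
  qed auto
  have "x0 \<in> X \<inter> B" using inB[OF x0] x0 by (simp add: r_def)
  then obtain z where z: "z \<in> X \<inter> B" "\<forall>x\<in>X \<inter> B. enorm d (vsub z y) \<le> enorm d (vsub x y)"
    using continuous_attains_inf[OF cK, of "\<lambda>x. enorm d (vsub x y)"]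
    by (auto intro: continuous_on_enorm_diff)
  have "enorm d (vsub z y) \<le> enorm d (vsub x y)" if "x \<in> X" for x
  proof (cases "enorm d (vsub x y) \<le> r")
    case True
    then show ?thesis using z inB that by blast
  next
    case False
    have "enorm d (vsub z y) \<le> r" using z \<open>x0 \<in> X \<inter> B\<close> r_def by blast
    then show ?thesis using False by linarith
  qed
  then show ?thesis
    using z by (intro that[of z]) (auto simp: is_arg_min_linorder)
qed

locale closed_convex =
  fixes d :: nat and X :: "(nat \<Rightarrow> real) set"
  assumes closed: "closed X" and subset_Rd: "X \<subseteq> Rd d" and convex: "convex_set X"
    and nonempty: "X \<noteq> {}"
begin

lemma projection_is_arg_min:
  "is_arg_min (\<lambda>x. enorm d (vsub x y)) (\<lambda>x. x \<in> X) (projection d X y)"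
proof -
  obtain z where "is_arg_min (\<lambda>x. enorm d (vsub x y)) (\<lambda>x. x \<in> X) z"
    using projection_exists[OF closed subset_Rd nonempty] .
  then show ?thesis
    unfolding projection_def arg_min_on_def arg_min_def
    by (rule someI[of "is_arg_min (\<lambda>x. enorm d (vsub x y)) (\<lambda>x. x \<in> X)"])
qed

lemma projection_in [simp]: "projection d X y \<in> X"
  using projection_is_arg_min by (simp add: is_arg_min_def)

text \<open>Moving from the projection towards \<open>z\<close> by a fraction \<open>u\<close> stays
  in \<open>X\<close>, hence cannot bring the point closer to \<open>y\<close>. Expanding the square
  and dividing by \<open>u\<close> bounds twice the inner product by \<open>u\<close> times a
  squared norm; then \<open>u\<close> tends to 0.\<close>

lemma projection_variational:
  assumes z: "z \<in> X"
  shows "einner d (vsub y (projection d X y)) (vsub z (projection d X y)) \<le> 0"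
proof -
  let ?P = "projection d X y"
  let ?a = "einner d (vsub y ?P) (vsub z ?P)" and ?b = "(enorm d (vsub z ?P))\<^sup>2"
  have *: "2 * ?a \<le> u * ?b" if u: "0 < u" "u \<le> 1" for u
  proof -
    have "(\<lambda>i. u * z i + (1 - u) * ?P i) \<in> X"
      using convex z projection_in[of y] u unfolding convex_set_def by auto
    then have "enorm d (vsub ?P y) \<le> enorm d (vsub (\<lambda>i. u * z i + (1 - u) * ?P i) y)"
      using projection_is_arg_min by (simp add: is_arg_min_linorder)
    also have "\<dots> = enorm d (vsub (vsub y ?P) (\<lambda>i. u * vsub z ?P i))"
      unfolding enorm_def L2_set_def
      by (intro arg_cong[where f = sqrt] sum.cong refl) (simp add: power2_eq_square algebra_simps)
    finally have "(enorm d (vsub y ?P))\<^sup>2 \<le> (enorm d (vsub (vsub y ?P) (\<lambda>i. u * vsub z ?P i)))\<^sup>2"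
      by (simp add: enorm_diff_commute[of d ?P y] power_mono)
    also have "\<dots> = (enorm d (vsub y ?P))\<^sup>2 - 2 * (u * ?a) + (u * enorm d (vsub z ?P))\<^sup>2"
      unfolding enorm_diff_power2[of d "vsub y ?P"] einner_scale_right enorm_scale using u by simp
    finally have "u * (2 * ?a) \<le> u * (u * ?b)"
      by (simp add: power2_eq_square algebra_simps)
    then show ?thesis using u by simp
  qed
  have "((\<lambda>u. u * ?b) \<longlongrightarrow> 0 * ?b) (at_right 0)"
    by (intro tendsto_intros)
  moreover have "eventually (\<lambda>u. 2 * ?a \<le> u * ?b) (at_right 0)"
    using * by (auto simp: eventually_at_right_field intro!: exI[of _ 1])
  ultimately have "2 * ?a \<le> 0 * ?b"
    by (rule tendsto_lowerbound) simp
  then show ?thesis by simp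
qed

text \<open>Adding the variational inequalities at the two projections bounds the square of their
  distance by its inner product with \<open>vsub x y\<close>; Cauchy-Schwarz does the rest.\<close>

lemma projection_nonexpansive:
  "enorm d (vsub (projection d X x) (projection d X y)) \<le> enorm d (vsub x y)"
proof -
  let ?P = "projection d X x" and ?Q = "projection d X y"
  let ?n = "enorm d (vsub ?P ?Q)"
  have "einner d (vsub x ?P) (vsub ?Q ?P) \<le> 0" "einner d (vsub y ?Q) (vsub ?P ?Q) \<le> 0"
    by (simp_all add: projection_variational)
  then have "einner d (vsub ?P ?Q) (vsub ?P ?Q) \<le> einner d (vsub x y) (vsub ?P ?Q)"
    by (simp add: einner_simps)
  then have "?n * ?n \<le> enorm d (vsub x y) * ?n"
    using einner_Cauchy_Schwarz[of d "vsub x y" "vsub ?P ?Q"]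
    by (simp flip: enorm_power2 add: power2_eq_square)
  then show ?thesis
    by (cases "?n = 0") (simp_all add: mult_le_cancel_right less_le del: mult_le_cancel_right1)
qed

lemma projection_fixed:
  assumes "z \<in> X" "i < d" shows "projection d X z i = z i"
proof -
  have "enorm d (vsub (projection d X z) z) \<le> enorm d (vsub z z)"
    using projection_is_arg_min[of z] assms unfolding is_arg_min_linorder by blast
  also have "\<dots> = 0" by (simp add: enorm_def L2_set_def)
  finally show ?thesis
    using abs_component_le_enorm[OF assms(2), of "vsub (projection d X z) z"] by simp
qed

lemma projection_contracts:
  assumes "z \<in> X"
  shows "enorm d (vsub (projection d X y) z) \<le> enorm d (vsub y z)"
proof -
  have "enorm d (vsub (projection d X y) z) = enorm d (vsub (projection d X y) (projection d X z))"
    by (simp add: enorm_def L2_set_def projection_fixed[OF assms])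
  then show ?thesis using projection_nonexpansive by metis
qed

text \<open>Each coordinate is continuous: below \<open>d\<close> it is 1-Lipschitz by
  nonexpansiveness, and from \<open>d\<close> on it is constantly 0 because \<open>X\<close> lies in
  \<open>Rd d\<close>.\<close>

lemma measurable_projection [measurable]: "projection d X \<in> borel_measurable borel"
proof (rule measurable_coordinatewise_then_product)
  fix i
  have "continuous_on UNIV (\<lambda>y. projection d X y i)"
  proof (cases "i < d")
    case True
    show ?thesis
    proof (rule continuous_on_if_le_enorm[where K = 1 and d = d])
      fix x y
      show "\<bar>projection d X y i - projection d X x i\<bar> \<le> 1 * enorm d (vsub y x)"
        using projection_nonexpansive[of y x]
          abs_component_le_enorm[OF True, of "vsub (projection d X y) (projection d X x)"] by simp
    qed
  next
    case False
    then have "projection d X y i = 0" for y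
      using subsetD[OF subset_Rd projection_in[of y]] by (simp add: topspace_Euclidean_space)
    then show ?thesis by simp
  qed
  then show "(\<lambda>y. projection d X y i) \<in> borel_measurable borel"
    by (rule borel_measurable_continuous_onI)
qed

lemma average_in:
  assumes "\<And>t. t < n \<Longrightarrow> x t \<in> X" "n \<ge> 1"
  shows "(\<lambda>i. (\<Sum>t<n. x t i) / real n) \<in> X"
  using assms(2,1)
proof (induction n rule: dec_induct)
  case base
  then show ?case by (simp add: eta_contract_eq)
next
  case (step n)
  \<comment> \<open>The new mean is a convex combination of the old mean, with weight
    \<open>?u\<close>, and the new point, with weight \<open>?v\<close>.\<close>
  let ?v = "1 / real (Suc n)" and ?u = "real n / real (Suc n)"
  have "(\<lambda>i. ?u * ((\<Sum>t<n. x t i) / real n) + ?v * x n i) \<in> X"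
    using convex[unfolded convex_set_def, rule_format, of "\<lambda>i. (\<Sum>t<n. x t i) / real n" "x n" ?u ?v]
      step by (simp add: add_divide_distrib[symmetric])
  moreover have "?u * ((\<Sum>t<n. x t i) / real n) + ?v * x n i = (\<Sum>t<Suc n. x t i) / real (Suc n)" for i
  proof -
    have "?u * (a / real n) + ?v * b = (a + b) / real (Suc n)" for a b :: real
      using step by (simp add: divide_simps)
    then show ?thesis by simp
  qed
  ultimately show ?case by simp
qed

end

section \<open>Error and bias caused by clipping\<close>

lemma enorm_clip:
  assumes "m > 0"
  shows "enorm d (clip d m y) = min (enorm d y) m"
  using assms unfolding clip_def enorm_scale
  by (cases "enorm d y = 0") (auto simp: min_def field_simps less_le)

lemma enorm_diff_clip:
  assumes "m > 0"
  shows "enorm d (vsub y (clip d m y)) = max 0 (enorm d y - m)"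
proof -
  have "vsub y (clip d m y) = (\<lambda>i. (1 - min 1 (m / enorm d y)) * y i)"
    by (auto simp: clip_def algebra_simps)
  then have "enorm d (vsub y (clip d m y)) = (1 - min 1 (m / enorm d y)) * enorm d y"
    by (simp add: enorm_scale)
  also have "\<dots> = max 0 (enorm d y - m)"
  proof (cases "m < enorm d y")
    case True
    then have "0 < enorm d y" using assms by linarith
    then show ?thesis using True assms by (simp add: min_def field_simps)
  next
    case False
    then show ?thesis
      by (cases "enorm d y = 0") (use assms in \<open>auto simp: min_def less_le\<close>)
  qed
  finally show ?thesis .
qed

text \<open>A clipped vector has norm at most \<open>m\<close>, which gives the first bound. For the
  second, clipping does nothing when \<open>enorm d y \<le> m\<close>; otherwise \<open>y\<close> is
  farther than \<open>m / 2\<close> from \<open>c\<close>, and three times that distance exceeds the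
  first bound.\<close>

lemma clip_error_le:
  assumes "m > 0" "enorm d c \<le> m / 2"
  shows "enorm d (vsub (clip d m y) c) \<le> 3 / 2 * m"
    and "enorm d (vsub (clip d m y) c) \<le> 3 * enorm d (vsub y c)"
proof -
  have "enorm d (vsub (clip d m y) c) \<le> enorm d (clip d m y) + enorm d c"
    using enorm_diff_triangle[of d "clip d m y" c "\<lambda>_. 0"] enorm_diff_commute[of d "\<lambda>_. 0" c] by simp
  then show *: "enorm d (vsub (clip d m y) c) \<le> 3 / 2 * m"
    using assms by (simp add: enorm_clip)
  have t: "enorm d y \<le> enorm d c + enorm d (vsub y c)"
    by (rule enorm_triangle_sub)
  show "enorm d (vsub (clip d m y) c) \<le> 3 * enorm d (vsub y c)"
  proof (cases "enorm d y \<le> m")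
    case True
    have "enorm d (vsub (clip d m y) c) \<le> enorm d (vsub (clip d m y) y) + enorm d (vsub y c)"
      by (rule enorm_diff_triangle)
    moreover have "enorm d (vsub (clip d m y) y) = 0"
      using True assms by (subst enorm_diff_commute) (simp add: enorm_diff_clip)
    ultimately show ?thesis
      using enorm_nonneg[of d "vsub y c"] by linarith
  next
    case False
    then show ?thesis using * t assms by linarith
  qed
qed

text \<open>With \<open>t\<close> the distance from \<open>y\<close> to \<open>c\<close> divided by
  \<open>m\<close>, the two previous bounds say that the error is at most
  \<open>3 * m * min 1 t\<close>. Since \<open>p \<le> 2\<close>, the square of
  \<open>min 1 t\<close> is at most \<open>t powr p\<close>: a second moment is traded for a
  \<open>p\<close>-th one.\<close>

lemma clip_error_moment:
  assumes "m > 0" "enorm d c \<le> m / 2" "p \<le> 2" "1 < p"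
  shows "(enorm d (vsub (clip d m y) c))\<^sup>2 \<le> 9 * m\<^sup>2 * (enorm d (vsub y c) / m) powr p"
proof -
  let ?k = "enorm d (vsub (clip d m y) c)" and ?t = "enorm d (vsub y c) / m"
  have t0: "0 \<le> ?t" using assms by simp
  have *: "?k \<le> 3 * m * min 1 ?t"
    using clip_error_le[OF assms(1,2), of y] assms(1) by (auto simp: min_def field_simps)
  have "(min 1 ?t)\<^sup>2 \<le> ?t powr p"
  proof (cases "?t \<le> 1")
    case True
    show ?thesis
    proof (cases "?t = 0")
      case False
      then have "?t\<^sup>2 = ?t powr 2" using t0 False by (subst powr_numeral) auto
      also have "\<dots> \<le> ?t powr p" using True t0 False assms by (intro powr_mono') auto
      finally show ?thesis using True by (simp add: min_absorb2)
    next
      case True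
      then have "min 1 ?t = 0" by (simp only:)
      then show ?thesis by (simp only: powr_ge_zero power_zero_numeral)
    qed
  next
    case False
    then have "1 \<le> ?t powr p" using assms by (intro ge_one_powr_ge_zero) auto
    then show ?thesis using False by simp
  qed
  then have "(3 * m * min 1 ?t)\<^sup>2 \<le> 9 * m\<^sup>2 * ?t powr p"
    using assms by (simp add: power_mult_distrib)
  moreover have "?k\<^sup>2 \<le> (3 * m * min 1 ?t)\<^sup>2"
    using * by (intro power_mono) auto
  ultimately show ?thesis by linarith
qed

text \<open>Something is cut off only if \<open>enorm d y > m\<close>, and then the relative
  distance \<open>t\<close> exceeds 1/2. So
  \<open>1 \<le> (2 * t) powr (p - 1) \<le> 2 * t powr (p - 1)\<close>, which raises the linear
  bound \<open>m * t\<close> on the cut-off part to the power \<open>p\<close>.\<close>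

lemma clip_bias_moment:
  assumes "m > 0" "enorm d c \<le> m / 2" "1 < p" "p \<le> 2"
  shows "enorm d (vsub y (clip d m y)) \<le> 2 * m * (enorm d (vsub y c) / m) powr p"
proof (cases "enorm d y \<le> m")
  case True
  then show ?thesis using assms by (simp add: enorm_diff_clip max_def)
next
  case False
  define t where "t = enorm d (vsub y c) / m"
  have "enorm d y \<le> enorm d c + enorm d (vsub y c)"
    by (rule enorm_triangle_sub)
  then have r: "enorm d y \<le> m / 2 + t * m" using assms by (simp add: t_def)
  then have "m / 2 < t * m" using False by linarith
  then have t: "1 / 2 < t" using assms by (simp add: field_simps)
  have "1 \<le> (2 * t) powr (p - 1)"
    using assms t by (intro ge_one_powr_ge_zero) auto
  also have "\<dots> = 2 powr (p - 1) * t powr (p - 1)"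
    by (rule powr_mult)
  also have "\<dots> \<le> 2 * t powr (p - 1)"
    using assms powr_mono[of "p - 1" 1 "2::real"] by (intro mult_right_mono) auto
  finally have "t * 1 \<le> t * (2 * t powr (p - 1))"
    using t by (intro mult_left_mono) auto
  also have "\<dots> = 2 * t powr p"
    using t by (simp add: powr_mult_base)
  finally have "m * t \<le> m * (2 * t powr p)" using assms by (intro mult_left_mono) auto
  moreover have "enorm d (vsub y (clip d m y)) \<le> m * t"
    using False r assms by (simp add: enorm_diff_clip algebra_simps)
  ultimately show ?thesis by (simp add: t_def algebra_simps)
qed

section \<open>Scalar bounds for the exponential of one increment\<close>

lemma exp_le_quadratic:
  fixes z :: real
  assumes "\<bar>z\<bar> \<le> 1"
  shows "exp z \<le> 1 + z + z\<^sup>2"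
proof (cases "0 \<le> z")
  case True
  then show ?thesis using assms exp_bound[of z] by simp
next
  case False
  have "1 - z + z\<^sup>2 / 2 \<le> exp (- z)"
    using exp_lower_Taylor_quadratic[of "- z"] False by simp
  \<comment> \<open>For negative \<open>z\<close> the claim is inverted: a lower bound for
    \<open>exp (- z)\<close> is available, and its product with the claimed bound is at least
    1.\<close>
  moreover have "1 \<le> (1 + z + z\<^sup>2) * (1 - z + z\<^sup>2 / 2)"
  proof -
    have "(1 + z + z\<^sup>2) * (1 - z + z\<^sup>2 / 2) = 1 + z\<^sup>2 / 2 + (- z) * z\<^sup>2 / 2 + z\<^sup>2 * z\<^sup>2 / 2"
      by (simp add: field_simps power2_eq_square)
    moreover have "0 \<le> (- z) * z\<^sup>2 / 2" using False by (intro divide_nonneg_nonneg mult_nonneg_nonneg) auto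
    moreover have "0 \<le> z\<^sup>2 / 2" "0 \<le> z\<^sup>2 * z\<^sup>2 / 2" by simp_all
    ultimately have "1 \<le> (1 + z + z\<^sup>2) * (1 - z + z\<^sup>2 / 2)" by linarith
    then show ?thesis .
  qed
  moreover have "0 \<le> 1 + z + z\<^sup>2" using assms by (simp add: add_nonneg_nonneg abs_le_iff)
  ultimately have "1 \<le> (1 + z + z\<^sup>2) * exp (- z)"
    by (meson mult_left_mono order_trans)
  then show ?thesis by (simp add: exp_minus field_simps)
qed

text \<open>Here \<open>n\<close> stands for the squared step length, \<open>u\<close> and
  \<open>v\<close> for the noise term with and without clipping, \<open>q\<close> for the
  \<open>p\<close>-th power of the relative noise and \<open>\<tau>\<close> for
  \<open>1 / T\<close>. The term in \<open>v\<close> is kept exactly, because its expectation will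
  vanish; replacing \<open>u\<close> by \<open>v\<close> costs only the clipping bias.\<close>

lemma exp_increment_le:
  fixes u v n q \<alpha> R \<tau> :: real
  assumes "0 < \<alpha>" "\<alpha> \<le> R" "0 \<le> q"
    and u: "\<bar>u\<bar> \<le> 3 / 2 * \<alpha> * R" "u\<^sup>2 \<le> 9 * \<alpha>\<^sup>2 * R\<^sup>2 * q" "v - u \<le> 2 * \<alpha> * R * q"
    and n: "0 \<le> n" "n \<le> \<alpha>\<^sup>2" "n \<le> 2 * \<alpha>\<^sup>2 * \<tau> + 18 * \<alpha>\<^sup>2 * q" and "0 \<le> \<tau>"
  shows "exp ((n - 2 * u) / (4 * \<alpha> * R)) \<le> 1 - v / (2 * \<alpha> * R) + \<tau> + 13 * q"
proof -
  have pos: "0 < \<alpha> * R" "0 < R" "0 < \<alpha>" using assms by auto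
  define U where "U = u / (\<alpha> * R)"
  define V where "V = v / (\<alpha> * R)"
  define N where "N = n / (\<alpha> * R)"
  define z where "z = (N - 2 * U) / 4"
  have "\<alpha>\<^sup>2 \<le> \<alpha> * R" using assms by (simp add: power2_eq_square)
  have N1: "0 \<le> N" "N \<le> 1" using \<open>\<alpha>\<^sup>2 \<le> \<alpha> * R\<close> n pos by (auto simp: N_def field_simps)
  have N2: "N \<le> 2 * \<tau> + 18 * q"
  proof -
    have "n \<le> \<alpha>\<^sup>2 * (2 * \<tau> + 18 * q)" using n by (simp add: algebra_simps)
    also have "\<dots> \<le> (\<alpha> * R) * (2 * \<tau> + 18 * q)"
      using \<open>\<alpha>\<^sup>2 \<le> \<alpha> * R\<close> assms by (intro mult_right_mono) auto
    finally show ?thesis using pos by (simp add: N_def field_simps)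
  qed
  have U1: "\<bar>U\<bar> \<le> 3 / 2" using u(1) pos unfolding U_def abs_divide by (simp add: field_simps)
  have U2: "U\<^sup>2 \<le> 9 * q"
  proof -
    have "U\<^sup>2 = u\<^sup>2 / (\<alpha> * R)\<^sup>2" by (simp add: U_def power_divide)
    also have "\<dots> \<le> (9 * q * (\<alpha> * R)\<^sup>2) / (\<alpha> * R)\<^sup>2"
      using u(2) by (intro divide_right_mono) (simp_all add: power_mult_distrib mult_ac)
    also have "\<dots> = 9 * q" using pos by (intro nonzero_mult_div_cancel_right power_not_zero) linarith
    finally show ?thesis .
  qed
  have UV: "V - U \<le> 2 * q" using u(3) pos by (simp add: U_def V_def field_simps)
  \<comment> \<open>The normalization by 4 is chosen here: \<open>N \<le> 1\<close> and
    \<open>\<bar>U\<bar> \<le> 3 / 2\<close> keep \<open>z\<close> in the range of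
    \<open>exp_le_quadratic\<close>.\<close>
  have z: "\<bar>z\<bar> \<le> 1" using N1 U1 unfolding z_def abs_le_iff by auto
  have "N\<^sup>2 \<le> N" using N1 by (simp add: power2_eq_square mult_left_le)
  have "z\<^sup>2 \<le> (2 * N\<^sup>2 + 8 * U\<^sup>2) / 16"
    using zero_le_power2[of "N + 2 * U"] unfolding z_def
    by (simp add: power2_eq_square field_simps)
  then have "z\<^sup>2 \<le> (2 * N + 8 * (9 * q)) / 16" using \<open>N\<^sup>2 \<le> N\<close> U2 by argo
  \<comment> \<open>The coefficients of \<open>q\<close> are 9/2 from \<open>N / 4\<close>, 1 from
    the bias, and 9/4 + 9/2 from the square, in total below 13; those of \<open>\<tau>\<close> are
    1/2 and 1/4.\<close>
  then have "1 + z + z\<^sup>2 \<le> 1 - V / 2 + \<tau> + 13 * q"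
    using N2 UV assms(10) assms(3) unfolding z_def by argo
  with exp_le_quadratic[OF z] have "exp z \<le> 1 - V / 2 + \<tau> + 13 * q" by linarith
  moreover have "z = (n - 2 * u) / (4 * \<alpha> * R)" "V / 2 = v / (2 * \<alpha> * R)"
    using pos by (simp_all add: z_def N_def U_def V_def field_simps)
  ultimately show ?thesis by simp
qed

section \<open>Measurability of the vector operations and dependence of the iterates on the
  past\<close>

lemma measurable_component:
  fixes f :: "'a \<Rightarrow> nat \<Rightarrow> real"
  assumes "f \<in> M \<rightarrow>\<^sub>M borel"
  shows "(\<lambda>\<omega>. f \<omega> i) \<in> borel_measurable M"
  using measurable_compose[OF assms measurable_product_coordinates] .

lemma measurable_enorm [measurable (raw)]:
  "f \<in> M \<rightarrow>\<^sub>M borel \<Longrightarrow> (\<lambda>\<omega>. enorm d (f \<omega>)) \<in> borel_measurable M"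
  unfolding enorm_def L2_set_def using measurable_component[of f M] by measurable

lemma measurable_einner [measurable (raw)]:
  "f \<in> M \<rightarrow>\<^sub>M borel \<Longrightarrow> g \<in> M \<rightarrow>\<^sub>M borel \<Longrightarrow> (\<lambda>\<omega>. einner d (f \<omega>) (g \<omega>)) \<in> borel_measurable M"
  unfolding einner_def 
  by (intro borel_measurable_sum borel_measurable_times measurable_component)

lemma measurable_vsub [measurable (raw)]:
  assumes "f \<in> M \<rightarrow>\<^sub>M borel" "g \<in> M \<rightarrow>\<^sub>M borel"
  shows "(\<lambda>\<omega>. vsub (f \<omega>) (g \<omega>)) \<in> M \<rightarrow>\<^sub>M borel"
  using measurable_component[OF assms(1)] measurable_component[OF assms(2)]
  by (intro measurable_coordinatewise_then_product) measurable

lemma measurable_clip [measurable (raw)]: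
  assumes "f \<in> M \<rightarrow>\<^sub>M borel"
  shows "(\<lambda>\<omega>. clip d m (f \<omega>)) \<in> M \<rightarrow>\<^sub>M borel"
proof (rule measurable_coordinatewise_then_product)
  show "(\<lambda>\<omega>. clip d m (f \<omega>) i) \<in> borel_measurable M" for i
    unfolding clip_def
    using measurable_component[OF assms] measurable_enorm[OF assms] by measurable
qed

lemma iterate_cong:
  "(\<And>i. i < t \<Longrightarrow> \<omega> i = \<omega>' i) \<Longrightarrow> iterate d X m \<eta> x1 \<omega> t = iterate d X m \<eta> x1 \<omega>' t"
  by (induction t) auto

lemma iterate_fun_upd [simp]:
  "t \<le> n \<Longrightarrow> iterate d X m \<eta> x1 (fun_upd \<omega> n y) t = iterate d X m \<eta> x1 \<omega> t"
  by (rule iterate_cong) auto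

section \<open>The objective on the feasible set\<close>

context stochastic_convex_problem
begin

lemma minimizer_in: "xs \<in> X"
  using minimizer by (simp add: is_arg_min_def)

sublocale closed_convex d X
proof
  show "closed X" "X \<subseteq> Rd d"
    using X_closed by (auto simp: closedin_Euclidean_space_iff)
qed (use X_convex minimizer_in in auto)

abbreviation grad :: "(nat \<Rightarrow> real) \<Rightarrow> nat \<Rightarrow> real" where
  "grad x \<equiv> mean_vec (Q x)"

definition f :: "(nat \<Rightarrow> real) \<Rightarrow> real" where
  "f x = real_of_ereal (F x)"

lemma F_eq_f: "x \<in> X \<Longrightarrow> F x = ereal (f x)"
proof -
  assume x: "x \<in> X"
  then have "x \<in> effective_domain d F"
    by (rule subsetD[OF order_trans[OF X_interior interior_of_subset]])
  then show ?thesis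
    using F_not_MInf[of x] unfolding f_def effective_domain_def by (cases "F x") auto
qed

lemma enorm_grad_le: "x \<in> X \<Longrightarrow> enorm d (grad x) \<le> G"
  using G_bound oracle_unbiased by blast

lemma f_ge_linearization:
  assumes "x \<in> X" "y \<in> X"
  shows "f y + einner d (grad y) (vsub x y) \<le> f x"
  using first_order[OF assms oracle_unbiased[OF assms(2)]] assms by (simp add: F_eq_f)

lemma f_minimum: "x \<in> X \<Longrightarrow> f xs \<le> f x"
  using minimizer by (simp add: is_arg_min_linorder F_eq_f[symmetric] flip: ereal_less_eq(3))

text \<open>Subgradients bounded by \<open>G\<close> make \<open>f\<close> Lipschitz on
  \<open>X\<close>. Continuity is what makes the suboptimality of the averaged iterate
  measurable.\<close>

lemma continuous_on_f: "continuous_on X f"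
proof (rule continuous_on_if_le_enorm[where K = G and d = d])
  have *: "f y - f x \<le> G * enorm d (vsub y x)" if "x \<in> X" "y \<in> X" for x y
  proof -
    have "f y - f x \<le> - einner d (grad y) (vsub x y)"
      using f_ge_linearization[OF that] by simp
    also have "\<dots> \<le> enorm d (grad y) * enorm d (vsub x y)"
      using einner_Cauchy_Schwarz[of d "grad y" "vsub x y"] by linarith
    also have "\<dots> \<le> G * enorm d (vsub y x)"
      using enorm_grad_le[OF that(2)] by (subst enorm_diff_commute) (intro mult_right_mono, auto)
    finally show ?thesis .
  qed
  show "\<bar>f y - f x\<bar> \<le> G * enorm d (vsub y x)" if "x \<in> X" "y \<in> X" for x y
    using *[OF that] *[OF that(2,1)] enorm_diff_commute[of d x y] by simp
qed

text \<open>Jensen's inequality from one subgradient: linearize \<open>f\<close> at the mean, where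
  the linear terms sum to 0.\<close>

lemma f_average_le:
  assumes "\<And>t. t < n \<Longrightarrow> x t \<in> X" "n \<ge> 1"
  shows "real n * f (\<lambda>i. (\<Sum>t<n. x t i) / real n) \<le> (\<Sum>t<n. f (x t))"
proof -
  let ?a = "\<lambda>i. (\<Sum>t<n. x t i) / real n"
  have "(\<Sum>t<n. einner d (grad ?a) (vsub (x t) ?a)) = einner d (grad ?a) (\<lambda>i. \<Sum>t<n. vsub (x t) ?a i)"
    unfolding einner_def sum_distrib_left by (rule sum.swap)
  also have "\<dots> = 0"
    using assms(2) by (simp add: einner_def sum_subtractf)
  finally have "real n * f ?a = (\<Sum>t<n. f ?a + einner d (grad ?a) (vsub (x t) ?a))"
    by (simp add: sum.distrib)
  also have "\<dots> \<le> (\<Sum>t<n. f (x t))"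
    using assms average_in[of n x] by (intro sum_mono f_ge_linearization) auto
  finally show ?thesis .
qed

lemma prob_space_Q: "x \<in> X \<Longrightarrow> prob_space (Q x)"
  and sets_Q: "x \<in> X \<Longrightarrow> sets (Q x) = sets (borel_Rd d)"
  using measurable_space[OF oracle_kernel, of x] by (auto simp: space_prob_algebra space_restrict_space)

lemma measurable_Q_ident: "x \<in> X \<Longrightarrow> (\<lambda>y. y) \<in> Q x \<rightarrow>\<^sub>M borel"
  by (subst measurable_cong_sets[OF sets_Q refl]) (auto intro: measurable_restrict_space1)

end

section \<open>One step of the algorithm\<close>

locale clipped_sgd = stochastic_convex_problem +
  fixes x1 :: "nat \<Rightarrow> real" and T :: nat and m \<eta> \<alpha> s R :: real
  assumes x1_in: "x1 \<in> X" and T_pos: "1 \<le> T"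
    and \<alpha>_pos: "0 < \<alpha>" and \<alpha>_le_R: "\<alpha> \<le> R"
    and m_ge: "2 * G \<le> m"
    and \<eta>_pos: "0 < \<eta>" and \<eta>_G: "\<eta> * G * sqrt T \<le> \<alpha>" and \<eta>_m: "\<eta> * m \<le> \<alpha>"
    and noise: "T * (\<sigma> / m) powr p \<le> s"
begin

lemma m_pos: "0 < m" using m_ge G_pos by linarith

lemma R_pos: "0 < R" using \<alpha>_pos \<alpha>_le_R by linarith

lemma s_nonneg: "0 \<le> s"
  using noise by (rule order_trans[rotated]) simp

text \<open>The \<open>Z\<close> of the overview at the point \<open>x\<close> and answer
  \<open>y\<close>: the squared step length minus twice the scaled error of the clipped gradient in
  the direction \<open>vsub x xs\<close>.\<close>

definition increment :: "(nat \<Rightarrow> real) \<Rightarrow> (nat \<Rightarrow> real) \<Rightarrow> real" where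
  "increment x y = (\<eta> * enorm d (clip d m y))\<^sup>2
     - 2 * (\<eta> * einner d (vsub (clip d m y) (grad x)) (vsub x xs))"

text \<open>Projecting does not increase the distance to \<open>xs\<close>, so the square for the
  unprojected step can be expanded. Splitting the clipped gradient into the mean gradient and an
  error leaves a term that the subgradient inequality compares with
  \<open>f x - f xs\<close>.\<close>

lemma descent:
  assumes "x \<in> X"
  shows "(enorm d (vsub (projection d X (vsub x (\<lambda>i. \<eta> * clip d m y i))) xs))\<^sup>2
      \<le> (enorm d (vsub x xs))\<^sup>2 - 2 * \<eta> * (f x - f xs) + increment x y"
proof -
  let ?g = "clip d m y" and ?w = "vsub x xs"
  have "(enorm d (vsub (projection d X (vsub x (\<lambda>i. \<eta> * ?g i))) xs))\<^sup>2
      \<le> (enorm d (vsub (vsub x (\<lambda>i. \<eta> * ?g i)) xs))\<^sup>2"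
    by (intro power_mono projection_contracts minimizer_in enorm_nonneg)
  also have "vsub (vsub x (\<lambda>i. \<eta> * ?g i)) xs = vsub ?w (\<lambda>i. \<eta> * ?g i)"
    by auto
  also have "(enorm d (vsub ?w (\<lambda>i. \<eta> * ?g i)))\<^sup>2
      = (enorm d ?w)\<^sup>2 - 2 * (\<eta> * einner d ?g ?w) + (\<eta> * enorm d ?g)\<^sup>2"
    unfolding enorm_diff_power2[of d ?w] einner_scale_right enorm_scale
    by (simp add: einner_commute[of d ?w] power_mult_distrib)
  also have "\<eta> * einner d ?g ?w
      = \<eta> * einner d (vsub ?g (grad x)) ?w + \<eta> * einner d (grad x) ?w"
    by (simp add: einner_diff_left algebra_simps)
  finally have 1: "(enorm d (vsub (projection d X (vsub x (\<lambda>i. \<eta> * ?g i))) xs))\<^sup>2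
      \<le> (enorm d ?w)\<^sup>2 - 2 * (\<eta> * einner d (grad x) ?w) + increment x y"
    by (simp add: increment_def)
  have "f x - f xs \<le> einner d (grad x) ?w"
    using f_ge_linearization[OF minimizer_in assms] by (simp add: einner_diff_right)
  then have "\<eta> * (f x - f xs) \<le> \<eta> * einner d (grad x) ?w"
    using \<eta>_pos by (intro mult_left_mono) auto
  with 1 show ?thesis by simp
qed

text \<open>The right-hand side is chosen so that the oracle assumptions integrate it directly: its
  random parts are the unclipped noise, which is linear with mean 0, and a \<open>p\<close>-th power
  of the noise. Clipping survives only in the constants.\<close>

lemma exp_increment_pointwise:
  assumes x: "x \<in> X" and w: "enorm d (vsub x xs) \<le> R"
  shows "exp (increment x y / (4 * \<alpha> * R))
    \<le> 1 - \<eta> * einner d (vsub y (grad x)) (vsub x xs) / (2 * \<alpha> * R) + 1 / T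
      + 13 * (enorm d (vsub y (grad x)) / m) powr p"
proof -
  let ?g = "clip d m y" and ?c = "grad x" and ?w = "vsub x xs"
  define q where "q = (enorm d (vsub y ?c) / m) powr p"
  define k where "k = enorm d (vsub ?g ?c)"
  define u where "u = \<eta> * einner d (vsub ?g ?c) ?w"
  define v where "v = \<eta> * einner d (vsub y ?c) ?w"
  have c: "enorm d ?c \<le> m / 2" "enorm d ?c \<le> G" using enorm_grad_le[OF x] m_ge by auto
  have q0: "0 \<le> q" by (simp add: q_def)
  have k0: "0 \<le> k" by (simp add: k_def)
  have k1: "\<eta> * k \<le> 3 / 2 * \<alpha>"
  proof -
    have "\<eta> * k \<le> \<eta> * (3 / 2 * m)"
      unfolding k_def using clip_error_le(1)[OF m_pos c(1)] \<eta>_pos by (intro mult_left_mono) auto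
    then show ?thesis using \<eta>_m by simp
  qed
  have \<eta>m2: "(\<eta> * m)\<^sup>2 \<le> \<alpha>\<^sup>2" using \<eta>_m \<eta>_pos m_pos by (intro power_mono) auto
  have k2: "(\<eta> * k)\<^sup>2 \<le> 9 * \<alpha>\<^sup>2 * q"
  proof -
    have "(\<eta> * k)\<^sup>2 \<le> \<eta>\<^sup>2 * (9 * m\<^sup>2 * q)"
      unfolding power_mult_distrib k_def q_def
      using clip_error_moment[OF m_pos c(1) p_range(2,1)] by (intro mult_left_mono) auto
    also have "\<dots> = 9 * q * (\<eta> * m)\<^sup>2" by (simp add: power_mult_distrib)
    also have "\<dots> \<le> 9 * q * \<alpha>\<^sup>2" using \<eta>m2 q0 by (intro mult_left_mono) auto
    finally show ?thesis by (simp add: mult_ac)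
  qed
  have uk: "\<bar>u\<bar> \<le> (\<eta> * k) * R"
  proof -
    have "\<bar>einner d (vsub ?g ?c) ?w\<bar> \<le> k * R"
      using einner_Cauchy_Schwarz[of d "vsub ?g ?c" ?w] mult_left_mono[OF w k0]
      unfolding k_def by linarith
    then show ?thesis unfolding u_def using \<eta>_pos by (simp add: abs_mult)
  qed
  have u1: "\<bar>u\<bar> \<le> 3 / 2 * \<alpha> * R"
    using uk mult_right_mono[OF k1, of R] R_pos by linarith
  have u2: "u\<^sup>2 \<le> 9 * \<alpha>\<^sup>2 * R\<^sup>2 * q"
  proof -
    have "u\<^sup>2 \<le> ((\<eta> * k) * R)\<^sup>2" using uk by (metis abs_ge_zero power2_abs power_mono)
    also have "\<dots> = (\<eta> * k)\<^sup>2 * R\<^sup>2" by (rule power_mult_distrib)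
    also have "\<dots> \<le> (9 * \<alpha>\<^sup>2 * q) * R\<^sup>2" using k2 by (intro mult_right_mono) auto
    finally show ?thesis by (simp add: mult_ac)
  qed
  have uv: "v - u \<le> 2 * \<alpha> * R * q"
  proof -
    have "v - u = \<eta> * einner d (vsub y ?g) ?w"
      by (simp add: u_def v_def einner_diff_left algebra_simps)
    also have "\<dots> \<le> \<eta> * (enorm d (vsub y ?g) * enorm d ?w)"
      using einner_Cauchy_Schwarz[of d "vsub y ?g" ?w] \<eta>_pos by (intro mult_left_mono) auto
    also have "\<dots> \<le> \<eta> * ((2 * m * q) * R)"
      using clip_bias_moment[OF m_pos c(1) p_range, of y] w \<eta>_pos m_pos q0
      unfolding q_def by (intro mult_left_mono mult_mono) auto
    also have "\<dots> = (2 * q * R) * (\<eta> * m)" by simp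
    also have "\<dots> \<le> (2 * q * R) * \<alpha>"
      using \<eta>_m q0 R_pos by (intro mult_left_mono) auto
    finally show ?thesis by (simp add: mult_ac)
  qed
  define n where "n = (\<eta> * enorm d ?g)\<^sup>2"
  have n1: "n \<le> \<alpha>\<^sup>2"
  proof -
    have "n \<le> (\<eta> * m)\<^sup>2"
      unfolding n_def using \<eta>_pos by (intro power_mono mult_left_mono) (auto simp: enorm_clip m_pos less_imp_le)
    then show ?thesis using \<eta>m2 by linarith
  qed
  have "(\<eta> * G)\<^sup>2 * T \<le> \<alpha>\<^sup>2"
  proof -
    have "(\<eta> * G * sqrt T)\<^sup>2 \<le> \<alpha>\<^sup>2" using \<eta>_G \<eta>_pos G_pos by (intro power_mono) auto
    then show ?thesis by (simp add: power_mult_distrib)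
  qed
  then have G2: "(\<eta> * G)\<^sup>2 \<le> \<alpha>\<^sup>2 * (1 / T)" using T_pos by (simp add: field_simps)
  \<comment> \<open>The norm of the clipped gradient is at most \<open>G + k\<close>. The
    \<open>G\<close> part of the squared step contributes \<open>\<alpha>\<^sup>2 / T\<close>, so
    that it sums to order \<open>\<alpha>\<^sup>2\<close> over all steps; the \<open>k\<close> part
    is controlled by the noise.\<close>
  have n2: "n \<le> 2 * \<alpha>\<^sup>2 * (1 / T) + 18 * \<alpha>\<^sup>2 * q"
  proof -
    have "enorm d ?g \<le> G + k"
      using enorm_triangle_sub[of d ?g ?c] c unfolding k_def by linarith
    then have "n \<le> (\<eta> * (G + k))\<^sup>2"
      unfolding n_def using \<eta>_pos by (intro power_mono mult_left_mono) auto
    also have "\<dots> \<le> 2 * (\<eta> * G)\<^sup>2 + 2 * (\<eta> * k)\<^sup>2"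
      using zero_le_power2[of "\<eta> * G - \<eta> * k"] by (simp add: power2_eq_square algebra_simps)
    finally show ?thesis using G2 k2 by linarith
  qed
  have "exp ((n - 2 * u) / (4 * \<alpha> * R)) \<le> 1 - v / (2 * \<alpha> * R) + 1 / T + 13 * q"
    by (rule exp_increment_le[OF \<alpha>_pos \<alpha>_le_R q0 u1 u2 uv _ n1 n2]) (auto simp: n_def)
  then show ?thesis
    by (simp add: n_def u_def v_def q_def increment_def)
qed

lemma measurable_increment_Q: "x \<in> X \<Longrightarrow> increment x \<in> borel_measurable (Q x)"
  unfolding increment_def[abs_def] using measurable_Q_ident[of x] by measurable

lemma exp_increment_expectation:
  assumes x: "x \<in> X" and w: "enorm d (vsub x xs) \<le> R"
  shows "(\<integral>\<^sup>+y. ennreal (exp (increment x y / (4 * \<alpha> * R))) \<partial>Q x) \<le> ennreal (exp ((1 + 13 * s) / T))"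
proof -
  interpret Q: prob_space "Q x" by (rule prob_space_Q[OF x])
  note [measurable] = measurable_Q_ident[OF x]
  let ?c = "grad x" and ?w = "vsub x xs"
  let ?r = "\<lambda>y. enorm d (vsub y ?c) powr p"
  have int_r: "integrable (Q x) ?r"
  proof (rule integrableI_nonneg)
    show "(\<integral>\<^sup>+y. ennreal (?r y) \<partial>Q x) < \<infinity>"
      using oracle_moment[OF x] by (rule order.strict_trans1) simp
  qed auto
  have "ennreal (\<integral>y. ?r y \<partial>Q x) \<le> ennreal (\<sigma> powr p)"
    using oracle_moment[OF x] by (subst nn_integral_eq_integral[symmetric, OF int_r]) auto
  then have r_le: "(\<integral>y. ?r y \<partial>Q x) \<le> \<sigma> powr p" by simp
  have q_eq: "(enorm d (vsub y ?c) / m) powr p = ?r y / m powr p" for y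
    using m_pos by (simp add: powr_divide)
  have "(\<integral>y. ?r y / m powr p \<partial>Q x) \<le> (\<sigma> / m) powr p"
    using r_le m_pos sigma_nonneg by (simp add: powr_divide divide_right_mono)
  also have "\<dots> \<le> s / T" using noise T_pos by (simp add: field_simps)
  finally have q_le: "(\<integral>y. ?r y / m powr p \<partial>Q x) \<le> s / T" .
  have int_i: "integrable (Q x) (\<lambda>y. (y i - ?c i) * ?w i)" for i
    using oracle_integrable[OF x] by auto
  then have int_lin: "integrable (Q x) (\<lambda>y. einner d (vsub y ?c) ?w)"
    unfolding einner_def by auto
  have "(\<integral>y. (y i - ?c i) * ?w i \<partial>Q x) = 0" for i
    using oracle_integrable[OF x, of i] by (simp add: mean_vec_def Q.prob_space)
  then have lin0: "(\<integral>y. einner d (vsub y ?c) ?w \<partial>Q x) = 0"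
    unfolding einner_def using int_i by (subst Bochner_Integration.integral_sum) (simp_all only: sum.neutral_const)
  let ?B = "\<lambda>y. 1 - \<eta> * einner d (vsub y ?c) ?w / (2 * \<alpha> * R) + 1 / T + 13 * (?r y / m powr p)"
  have B: "exp (increment x y / (4 * \<alpha> * R)) \<le> ?B y" for y
    using exp_increment_pointwise[OF x w, of y] by (simp add: q_eq)
  \<comment> \<open>Nonnegativity comes for free, as \<open>?B\<close> dominates an exponential; it
    lets the nonnegative integral be computed as a Bochner integral.\<close>
  have B0: "0 \<le> ?B y" for y
    using B[of y] by (meson exp_ge_zero order_trans)
  have int_B: "integrable (Q x) ?B"
    using int_lin int_r by (intro Bochner_Integration.integrable_add Bochner_Integration.integrable_diff) auto
  have "(\<integral>\<^sup>+y. ennreal (exp (increment x y / (4 * \<alpha> * R))) \<partial>Q x) \<le> (\<integral>\<^sup>+y. ennreal (?B y) \<partial>Q x)"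
    using B by (intro nn_integral_mono ennreal_leI) auto
  also have "\<dots> = ennreal (\<integral>y. ?B y \<partial>Q x)"
    using B0 by (intro nn_integral_eq_integral int_B) auto
  also have "(\<integral>y. ?B y \<partial>Q x) = 1 + 1 / T + 13 * (\<integral>y. ?r y / m powr p \<partial>Q x)"
    using int_lin int_r lin0 by (simp add: Q.prob_space)
  also have "ennreal \<dots> \<le> ennreal (exp ((1 + 13 * s) / T))"
  proof (rule ennreal_leI)
    have "1 + 1 / T + 13 * (\<integral>y. ?r y / m powr p \<partial>Q x) \<le> 1 + (1 + 13 * s) / T"
      using q_le by (simp add: add_divide_distrib)
    also have "\<dots> \<le> exp ((1 + 13 * s) / T)"
      by (rule exp_ge_add_one_self)
    finally show "1 + 1 / T + 13 * (\<integral>y. ?r y / m powr p \<partial>Q x) \<le> exp ((1 + 13 * s) / T)" .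
  qed
  finally show ?thesis .
qed

section \<open>The law of the answers and measurability along the run\<close>

abbreviation x :: "(nat \<Rightarrow> nat \<Rightarrow> real) \<Rightarrow> nat \<Rightarrow> nat \<Rightarrow> real" where
  "x \<omega> t \<equiv> iterate d X (\<lambda>_. m) (\<lambda>_. \<eta>) x1 \<omega> t"

abbreviation answers :: "nat \<Rightarrow> (nat \<Rightarrow> nat \<Rightarrow> real) measure" where
  "answers n \<equiv> PiM {0..<n} (\<lambda>_. borel_Rd d)"

lemma x_in: "x \<omega> t \<in> X"
  by (cases t) (simp_all add: x1_in)

lemma measurable_answer: "i < n \<Longrightarrow> (\<lambda>\<omega>. \<omega> i) \<in> answers n \<rightarrow>\<^sub>M borel"
proof -
  assume "i < n"
  then have "(\<lambda>\<omega>. \<omega> i) \<in> answers n \<rightarrow>\<^sub>M borel_Rd d"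
    by (intro measurable_component_singleton) auto
  then show ?thesis by (simp add: measurable_restrict_space2_iff)
qed

lemma measurable_x: "t \<le> n \<Longrightarrow> (\<lambda>\<omega>. x \<omega> t) \<in> answers n \<rightarrow>\<^sub>M borel"
proof (induction t)
  case (Suc t)
  have c: "(\<lambda>\<omega>. clip d m (\<omega> t)) \<in> answers n \<rightarrow>\<^sub>M borel"
    using measurable_answer[of t n] Suc.prems by (intro measurable_clip) auto
  have "(\<lambda>\<omega>. \<lambda>i. \<eta> * clip d m (\<omega> t) i) \<in> answers n \<rightarrow>\<^sub>M borel"
    using measurable_component[OF c] by (intro measurable_coordinatewise_then_product) measurable
  with Suc show ?case
    by (auto intro!: measurable_compose[OF _ measurable_projection] measurable_vsub)
qed simp

lemma measurable_x_restrict: "t \<le> n \<Longrightarrow> (\<lambda>\<omega>. x \<omega> t) \<in> answers n \<rightarrow>\<^sub>M restrict_space borel X"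
  by (intro measurable_restrict_space2 measurable_x) (auto simp: x_in)

lemma measurable_Q_x: "t \<le> n \<Longrightarrow> (\<lambda>\<omega>. Q (x \<omega> t)) \<in> answers n \<rightarrow>\<^sub>M subprob_algebra (borel_Rd d)"
  by (rule measurable_compose[OF measurable_x_restrict measurable_prob_algebraD[OF oracle_kernel]])

text \<open>The mean is an integral against the kernel, and integration of a fixed measurable
  function is measurable on \<open>subprob_algebra\<close>.\<close>

lemma measurable_grad_x: "t \<le> n \<Longrightarrow> (\<lambda>\<omega>. grad (x \<omega> t)) \<in> answers n \<rightarrow>\<^sub>M borel"
proof (rule measurable_coordinatewise_then_product)
  fix i assume "t \<le> n"
  have "(\<lambda>y. y i) \<in> borel_measurable (borel_Rd d)"
    by (intro measurable_restrict_space1) simp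
  then have "(\<lambda>M. \<integral>y. y i \<partial>M) \<in> borel_measurable (subprob_algebra (borel_Rd d))"
    by (rule integral_measurable_subprob_algebra)
  from measurable_compose[OF measurable_Q_x[OF \<open>t \<le> n\<close>] this]
  show "(\<lambda>\<omega>. grad (x \<omega> t) i) \<in> borel_measurable (answers n)"
    by (simp add: mean_vec_def)
qed

text \<open>The kernel sees the history only through the current iterate, which always lies in
  \<open>X\<close>, where \<open>Q\<close> gives probability measures. Run from the empty history,
  \<open>IT.C\<close> is \<open>answers_law\<close>.\<close>

sublocale IT: Ionescu_Tulcea "\<lambda>t \<omega>. Q (x \<omega> t)" "\<lambda>_. borel_Rd d"
  by (rule Ionescu_Tulcea.intro) (simp_all only: measurable_Q_x prob_space_Q[OF x_in] order_refl)

abbreviation law :: "nat \<Rightarrow> (nat \<Rightarrow> nat \<Rightarrow> real) measure" where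
  "law n \<equiv> IT.C 0 n (\<lambda>_. undefined)"

lemma empty_history: "(\<lambda>_. undefined) \<in> space (answers 0)"
  by (simp add: space_PiM_empty)

lemma sets_law: "sets (law n) = sets (answers n)"
  using IT.sets_C[OF empty_history, of n] by simp

lemma prob_space_law: "prob_space (law n)"
  by (rule IT.prob_space_C[OF empty_history])

section \<open>The stopped sum and its exponential moment\<close>

definition active :: "(nat \<Rightarrow> nat \<Rightarrow> real) \<Rightarrow> nat \<Rightarrow> bool" where
  "active \<omega> t \<longleftrightarrow> (\<forall>j\<le>t. enorm d (vsub (x \<omega> j) xs) \<le> R)"

definition drift :: "(nat \<Rightarrow> nat \<Rightarrow> real) \<Rightarrow> nat \<Rightarrow> real" where
  "drift \<omega> n = (\<Sum>t<n. if active \<omega> t then increment (x \<omega> t) (\<omega> t) else 0)"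

lemma active_antimono: "active \<omega> t \<Longrightarrow> j \<le> t \<Longrightarrow> active \<omega> j"
  by (auto simp: active_def)

lemma active_Suc: "active \<omega> (Suc t) \<longleftrightarrow> active \<omega> t \<and> enorm d (vsub (x \<omega> (Suc t)) xs) \<le> R"
  by (auto simp add: active_def le_Suc_eq simp del: iterate.simps)

lemma active_fun_upd [simp]: "t \<le> n \<Longrightarrow> active (fun_upd \<omega> n y) t = active \<omega> t"
  by (simp add: active_def)

lemma drift_fun_upd [simp]: "drift (fun_upd \<omega> n y) n = drift \<omega> n"
  unfolding drift_def by (intro sum.cong) auto

text \<open>Both \<open>active \<omega> n\<close> and \<open>x \<omega> n\<close> are determined by
  the answers before index \<open>n\<close>, so the answer \<open>n\<close> enters through the last
  summand alone and the earlier sum is a constant for the conditional expectation.\<close>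

lemma drift_Suc_fun_upd:
  "drift (fun_upd \<omega> n y) (Suc n) = drift \<omega> n + (if active \<omega> n then increment (x \<omega> n) y else 0)"
  using drift_fun_upd[of \<omega> n y] by (simp add: drift_def)

lemma measurable_drift: "(\<lambda>\<omega>. drift \<omega> n) \<in> borel_measurable (answers n)"
  unfolding drift_def
proof (intro borel_measurable_sum measurable_If)
  fix t assume "t \<in> {..<n}"
  then have t: "t < n" by simp
  note [measurable] = measurable_x[OF less_imp_le[OF t]] measurable_answer[OF t]
    measurable_grad_x[OF less_imp_le[OF t]]
  show "(\<lambda>\<omega>. increment (x \<omega> t) (\<omega> t)) \<in> borel_measurable (answers n)"
    unfolding increment_def by measurable
  have [measurable]: "(\<lambda>\<omega>. enorm d (vsub (x \<omega> j) xs)) \<in> borel_measurable (answers n)" if "j \<le> t" for j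
    using measurable_x[of j n] that t by (intro measurable_enorm measurable_vsub) auto
  have "{\<omega> \<in> space (answers n). active \<omega> t}
      = (\<Inter>j\<in>{..t}. {\<omega> \<in> space (answers n). enorm d (vsub (x \<omega> j) xs) \<le> R})"
    by (auto simp: active_def)
  also have "\<dots> \<in> sets (answers n)"
    by (intro sets.finite_INT) (auto, measurable)
  finally show "{\<omega> \<in> space (answers n). active \<omega> t} \<in> sets (answers n)" .
qed simp

text \<open>Conditionally on the history each new factor has expectation at most
  \<open>exp ((1 + 13 * s) / T)\<close>: by \<open>exp_increment_expectation\<close> while active,
  and because a switched-off factor equals 1 afterwards. Induction multiplies these bounds.\<close>

lemma exp_drift_expectation:
  "(\<integral>\<^sup>+\<omega>. ennreal (exp (drift \<omega> n / (4 * \<alpha> * R))) \<partial>law n) \<le> ennreal (exp (n * ((1 + 13 * s) / T)))"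
proof (induction n)
  case 0
  then show ?case
    using prob_space.emeasure_space_1[OF prob_space_law[of 0]] by (simp add: drift_def)
next
  case (Suc n)
  let ?e = "\<lambda>r. ennreal (exp (r / (4 * \<alpha> * R)))" and ?b = "exp ((1 + 13 * s) / T)"
  note [measurable] = measurable_drift[of n] measurable_drift[of "Suc n"]
  have step: "(\<integral>\<^sup>+\<omega>'. ?e (drift \<omega>' (Suc n)) \<partial>IT.eP n \<omega>) \<le> ?e (drift \<omega> n) * ennreal ?b"
    if \<omega>: "\<omega> \<in> space (answers n)" for \<omega>
  proof -
    \<comment> \<open>\<open>IT.eP n \<omega>\<close> appends answer \<open>n\<close> to a fixed
      history, so integrating over it is integrating over the oracle's law at the current
      iterate.\<close>
    have "(\<integral>\<^sup>+\<omega>'. ?e (drift \<omega>' (Suc n)) \<partial>IT.eP n \<omega>)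
        = (\<integral>\<^sup>+y. ?e (drift (fun_upd \<omega> n y) (Suc n)) \<partial>Q (x \<omega> n))"
      by (rule IT.nn_integral_eP[OF \<omega>]) measurable
    also have "\<dots> = (\<integral>\<^sup>+y. ?e (drift \<omega> n) * ?e (if active \<omega> n then increment (x \<omega> n) y else 0) \<partial>Q (x \<omega> n))"
      by (simp add: drift_Suc_fun_upd add_divide_distrib exp_add ennreal_mult del: if_split)
    also have "\<dots> = ?e (drift \<omega> n) * (\<integral>\<^sup>+y. ?e (if active \<omega> n then increment (x \<omega> n) y else 0) \<partial>Q (x \<omega> n))"
      using measurable_increment_Q[OF x_in, of \<omega> n]
      by (intro nn_integral_cmult) (cases "active \<omega> n", auto)
    also have "\<dots> \<le> ?e (drift \<omega> n) * ennreal ?b"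
    proof (intro mult_left_mono)
      show "(\<integral>\<^sup>+y. ?e (if active \<omega> n then increment (x \<omega> n) y else 0) \<partial>Q (x \<omega> n)) \<le> ennreal ?b"
      proof (cases "active \<omega> n")
        case True
        then show ?thesis
          using exp_increment_expectation[OF x_in, of \<omega> n] by (simp add: active_def)
      next
        case False
        have "1 \<le> ?b" using s_nonneg by simp
        then show ?thesis
          using False prob_space.emeasure_space_1[OF prob_space_Q[OF x_in, of \<omega> n]] by simp
      qed
    qed simp
    finally show ?thesis .
  qed
  have "(\<integral>\<^sup>+\<omega>. ?e (drift \<omega> (Suc n)) \<partial>law (Suc n))
      = (\<integral>\<^sup>+\<omega>. \<integral>\<^sup>+\<omega>'. ?e (drift \<omega>' (Suc n)) \<partial>IT.eP n \<omega> \<partial>law n)"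
    unfolding IT.C.simps add_0
    by (rule nn_integral_bind[where B = "answers (Suc n)"])
       (measurable, simp add: measurable_cong_sets[OF sets_law refl] IT.measurable_eP)
  also have "\<dots> \<le> (\<integral>\<^sup>+\<omega>. ?e (drift \<omega> n) * ennreal ?b \<partial>law n)"
    using step IT.space_C[OF empty_history, of n] by (intro nn_integral_mono) simp
  also have "\<dots> = (\<integral>\<^sup>+\<omega>. ?e (drift \<omega> n) \<partial>law n) * ennreal ?b"
    by (intro nn_integral_multc) (simp add: measurable_cong_sets[OF sets_law refl])
  also have "\<dots> \<le> ennreal (exp (n * ((1 + 13 * s) / T))) * ennreal ?b"
    using Suc.IH by (intro mult_right_mono) auto
  also have "\<dots> = ennreal (exp (Suc n * ((1 + 13 * s) / T)))"
  proof -
    have "exp (n * b) * exp b = exp (Suc n * b)" for b :: real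
      by (simp add: algebra_simps flip: exp_add)
    then show ?thesis by (simp only: ennreal_mult[symmetric] exp_ge_zero)
  qed
  finally show ?case .
qed

text \<open>
  As long as the iterates stay in the ball, the stopped sum agrees with the true one,
  and the bound on it keeps the next iterate in the ball.
\<close>

lemma regret_le:
  assumes small: "(enorm d (vsub x1 xs))\<^sup>2 + drift \<omega> T \<le> R\<^sup>2"
    and start: "enorm d (vsub x1 xs) \<le> R"
  shows "2 * \<eta> * (\<Sum>t<T. f (x \<omega> t) - f xs) \<le> R\<^sup>2"
proof -
  have sum_le: "(enorm d (vsub (x \<omega> n) xs))\<^sup>2 + 2 * \<eta> * (\<Sum>t<n. f (x \<omega> t) - f xs)
      \<le> (enorm d (vsub x1 xs))\<^sup>2 + drift \<omega> n" if "\<And>t. t < n \<Longrightarrow> active \<omega> t" for n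
    using that
  proof (induction n)
    case (Suc n)
    have "(enorm d (vsub (x \<omega> (Suc n)) xs))\<^sup>2
        \<le> (enorm d (vsub (x \<omega> n) xs))\<^sup>2 - 2 * \<eta> * (f (x \<omega> n) - f xs) + increment (x \<omega> n) (\<omega> n)"
      using descent[OF x_in] by simp
    moreover have "drift \<omega> (Suc n) = drift \<omega> n + increment (x \<omega> n) (\<omega> n)"
      using Suc.prems[of n] by (simp add: drift_def)
    moreover have "(enorm d (vsub (x \<omega> n) xs))\<^sup>2 + 2 * \<eta> * (\<Sum>t<n. f (x \<omega> t) - f xs)
        \<le> (enorm d (vsub x1 xs))\<^sup>2 + drift \<omega> n"
      using Suc by simp
    ultimately show ?case by (simp add: algebra_simps)
  qed (simp add: drift_def)
  have regret_nonneg: "0 \<le> 2 * \<eta> * (\<Sum>t<n. f (x \<omega> t) - f xs)" for n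
    using \<eta>_pos f_minimum[OF x_in] by (intro mult_nonneg_nonneg sum_nonneg) auto
  have act: "active \<omega> n" if "n \<le> T" for n
    using that
  proof (induction n)
    case 0
    then show ?case using start by (simp add: active_def)
  next
    case (Suc n)
    have an: "active \<omega> t" if "t < Suc n" for t
      using Suc that by (auto simp: active_def)
    show ?case
    proof (rule ccontr)
      assume na: "\<not> active \<omega> (Suc n)"
      then have "\<not> active \<omega> t" if "Suc n \<le> t" for t
        using that active_antimono by blast
      \<comment> \<open>All summands after the exit vanish, so the sum at time \<open>T\<close> is
        still the one at the exit. This is how a bound at the final time alone excludes an exit at
        any step.\<close>
      then have "drift \<omega> T = drift \<omega> (Suc n)"
        unfolding drift_def using Suc.prems by (intro sum.mono_neutral_right) auto
      then have "(enorm d (vsub (x \<omega> (Suc n)) xs))\<^sup>2 \<le> R\<^sup>2"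
        using sum_le[of "Suc n", OF an] regret_nonneg[of "Suc n"] small by linarith
      then have "enorm d (vsub (x \<omega> (Suc n)) xs) \<le> R"
        by (rule power2_le_imp_le[OF _ less_imp_le[OF R_pos]])
      then have "active \<omega> (Suc n)"
        using an[of n] by (simp add: active_Suc del: iterate.simps)
      then show False using na by simp
    qed
  qed
  show ?thesis
    using sum_le[of T, OF act[OF less_imp_le]] small zero_le_power2[of "enorm d (vsub (x \<omega> T) xs)"]
    by linarith
qed

section \<open>High-probability bound for the averaged iterate\<close>

abbreviation xbar :: "(nat \<Rightarrow> nat \<Rightarrow> real) \<Rightarrow> nat \<Rightarrow> real" where
  "xbar \<omega> \<equiv> average_iterate d X (\<lambda>_. m) (\<lambda>_. \<eta>) x1 T \<omega>"

lemma xbar_in: "xbar \<omega> \<in> X"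
  unfolding average_iterate_def by (rule average_in[OF x_in T_pos])

lemma measurable_f_xbar: "(\<lambda>\<omega>. f (xbar \<omega>)) \<in> borel_measurable (answers T)"
proof -
  have "(\<lambda>\<omega>. x \<omega> t i) \<in> borel_measurable (answers T)" if "t < T" for t i
    using measurable_component[OF measurable_x[of t T]] that by simp
  then have "(\<lambda>\<omega>. xbar \<omega>) \<in> answers T \<rightarrow>\<^sub>M borel"
    unfolding average_iterate_def
    by (intro measurable_coordinatewise_then_product borel_measurable_divide borel_measurable_sum) auto
  then have "(\<lambda>\<omega>. xbar \<omega>) \<in> answers T \<rightarrow>\<^sub>M restrict_space borel X"
    by (intro measurable_restrict_space2) (auto simp: xbar_in)
  then show ?thesis
    by (rule measurable_compose[OF _ borel_measurable_continuous_on_restrict[OF continuous_on_f]])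
qed

text \<open>Markov's inequality for the exponential of the stopped sum confines failure to an event
  of probability at most \<open>\<delta>\<close>. Off that event \<open>radius\<close> yields the
  hypotheses of \<open>regret_le\<close>, and Jensen's inequality with \<open>B\<close> turns the
  regret bound into one for the average.\<close>

lemma suboptimality_high_probability:
  assumes \<delta>: "0 < \<delta>" "\<delta> \<le> 1"
    and radius: "(enorm d (vsub x1 xs))\<^sup>2 + 4 * \<alpha> * R * (1 + 13 * s + ln (1 / \<delta>)) \<le> R\<^sup>2"
    and B: "R\<^sup>2 \<le> 2 * \<eta> * T * B"
  shows "1 - \<delta> \<le> measure (law T) {\<omega> \<in> space (law T). F (xbar \<omega>) - F xs \<le> ereal B}"
proof -
  interpret P: prob_space "law T" by (rule prob_space_law)
  \<comment> \<open>The exponential moment at time \<open>T\<close> is at most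
    \<open>exp (1 + 13 * s)\<close>, so this weight makes Markov's bound equal to
    \<open>\<delta>\<close>.\<close>
  define c where "c = \<delta> * exp (- (1 + 13 * s))"
  have aR: "0 < 4 * \<alpha> * R" using \<alpha>_pos R_pos by simp
  define bad where "bad = {\<omega> \<in> space (law T). 1 \<le> ennreal c * ennreal (exp (drift \<omega> T / (4 * \<alpha> * R)))}"
  have mdrift [measurable]: "(\<lambda>\<omega>. drift \<omega> T) \<in> borel_measurable (law T)"
    using measurable_drift by (simp add: measurable_cong_sets[OF sets_law refl])
  have mf [measurable]: "(\<lambda>\<omega>. f (xbar \<omega>)) \<in> borel_measurable (law T)"
    using measurable_f_xbar by (simp add: measurable_cong_sets[OF sets_law refl])
  have bad_meas [measurable]: "bad \<in> sets (law T)" unfolding bad_def by measurable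
  have "emeasure (law T) bad
      \<le> ennreal c * (\<integral>\<^sup>+\<omega>. ennreal (exp (drift \<omega> T / (4 * \<alpha> * R))) * indicator (space (law T)) \<omega> \<partial>law T)"
    unfolding bad_def by (intro nn_integral_Markov_inequality) auto
  also have "\<dots> = ennreal c * (\<integral>\<^sup>+\<omega>. ennreal (exp (drift \<omega> T / (4 * \<alpha> * R))) \<partial>law T)"
    by (intro arg_cong2[where f = times] refl nn_integral_cong) simp
  also have "\<dots> \<le> ennreal c * ennreal (exp (T * ((1 + 13 * s) / T)))"
    by (intro mult_left_mono exp_drift_expectation) simp
  also have "\<dots> = ennreal \<delta>"
    using \<delta> T_pos by (simp add: c_def ennreal_mult[symmetric] mult.assoc flip: exp_add)
  finally have "measure (law T) bad \<le> \<delta>"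
    using \<delta> by (simp add: P.emeasure_eq_measure)
  then have "1 - \<delta> \<le> measure (law T) (space (law T) - bad)"
    by (simp add: P.prob_compl)
  also have "\<dots> \<le> measure (law T) {\<omega> \<in> space (law T). f (xbar \<omega>) - f xs \<le> B}"
  proof (rule P.finite_measure_mono)
    show "space (law T) - bad \<subseteq> {\<omega> \<in> space (law T). f (xbar \<omega>) - f xs \<le> B}"
    proof
      fix \<omega> assume "\<omega> \<in> space (law T) - bad"
      then have \<omega>: "\<omega> \<in> space (law T)" and "\<not> 1 \<le> ennreal (c * exp (drift \<omega> T / (4 * \<alpha> * R)))"
        using \<delta> by (auto simp: bad_def c_def ennreal_mult)
      then have "c * exp (drift \<omega> T / (4 * \<alpha> * R)) < 1"
        by (simp add: not_le ennreal_less_one_iff)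
      then have "exp (drift \<omega> T / (4 * \<alpha> * R)) < 1 / c"
        using \<delta> by (subst pos_less_divide_eq) (simp_all add: c_def mult.commute)
      also have "1 / c = exp (1 + 13 * s + ln (1 / \<delta>))"
        using \<delta> unfolding c_def exp_add[of "1 + 13 * s"] exp_minus[of "1 + 13 * s"]
        by (subst exp_ln) (simp_all add: divide_inverse mult.commute)
      finally have "exp (drift \<omega> T / (4 * \<alpha> * R)) < exp (1 + 13 * s + ln (1 / \<delta>))" .
      then have "drift \<omega> T / (4 * \<alpha> * R) < 1 + 13 * s + ln (1 / \<delta>)"
        by (simp only: exp_less_cancel_iff)
      then have "drift \<omega> T \<le> 4 * \<alpha> * R * (1 + 13 * s + ln (1 / \<delta>))"
        using aR by (simp add: pos_divide_less_eq mult_ac)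
      then have small: "(enorm d (vsub x1 xs))\<^sup>2 + drift \<omega> T \<le> R\<^sup>2" using radius by linarith
      have "0 \<le> 4 * \<alpha> * R * (1 + 13 * s + ln (1 / \<delta>))"
        using s_nonneg \<delta> by (intro mult_nonneg_nonneg[OF less_imp_le[OF aR]] add_nonneg_nonneg) auto
      then have "(enorm d (vsub x1 xs))\<^sup>2 \<le> R\<^sup>2" using radius by linarith
      then have start: "enorm d (vsub x1 xs) \<le> R"
        by (rule power2_le_imp_le[OF _ less_imp_le[OF R_pos]])
      have "real T * f (xbar \<omega>) \<le> (\<Sum>t<T. f (x \<omega> t))"
        unfolding average_iterate_def by (rule f_average_le[OF x_in T_pos])
      then have "real T * (f (xbar \<omega>) - f xs) \<le> (\<Sum>t<T. f (x \<omega> t) - f xs)"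
        by (simp add: sum_subtractf algebra_simps)
      then have "2 * \<eta> * (real T * (f (xbar \<omega>) - f xs)) \<le> 2 * \<eta> * (\<Sum>t<T. f (x \<omega> t) - f xs)"
        using \<eta>_pos by (intro mult_left_mono) auto
      also have "\<dots> \<le> 2 * \<eta> * T * B"
        using regret_le[OF small start] B by linarith
      finally have "(2 * \<eta> * T) * (f (xbar \<omega>) - f xs) \<le> (2 * \<eta> * T) * B"
        by (simp only: mult.assoc)
      then have "f (xbar \<omega>) - f xs \<le> B"
        using \<eta>_pos T_pos by (subst (asm) mult_le_cancel_left_pos) auto
      then show "\<omega> \<in> {\<omega> \<in> space (law T). f (xbar \<omega>) - f xs \<le> B}" using \<omega> by simp
    qed
  qed measurable
  also have "{\<omega> \<in> space (law T). f (xbar \<omega>) - f xs \<le> B}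
      = {\<omega> \<in> space (law T). F (xbar \<omega>) - F xs \<le> ereal B}"
    by (simp add: F_eq_f xbar_in minimizer_in)
  finally show ?thesis .
qed

end

section \<open>Choice of the radius and size of the parameters\<close>

lemma radius_bound:
  fixes \<alpha> D L s :: real
  assumes "0 < \<alpha>" "0 \<le> D" "1 \<le> L" "0 \<le> s"
  defines "R \<equiv> 8 * \<alpha> * (1 + 13 * s + L) + 2 * D"
  shows "\<alpha> \<le> R" "D\<^sup>2 + 4 * \<alpha> * R * (1 + 13 * s + L) \<le> R\<^sup>2"
    "R\<^sup>2 \<le> 50000 * (\<alpha>\<^sup>2 * L * s\<^sup>2 + \<alpha>\<^sup>2 * L\<^sup>2 + D\<^sup>2)"
proof -
  \<comment> \<open>Now \<open>R\<close> is \<open>8 * \<alpha> * c + 2 * D\<close>, so half of it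
    dominates \<open>4 * \<alpha> * c\<close> as well as \<open>D\<close>. The quadratic condition
    on \<open>R\<close> then costs at most three quarters of its square.\<close>
  define c where "c = 1 + 13 * s + L"
  have c: "1 \<le> c" "c \<le> 2 * L + 13 * s" using assms by (auto simp: c_def)
  have R: "R = 8 * (\<alpha> * c) + 2 * D" by (simp add: R_def c_def)
  have "\<alpha> * 1 \<le> \<alpha> * c" using c assms by (intro mult_left_mono) auto
  then show "\<alpha> \<le> R" using assms R by linarith
  then have "0 \<le> R" using assms by linarith
  have "0 \<le> (\<alpha> * c)" using assms c by simp
  then have "4 * (\<alpha> * c) \<le> R / 2" "D \<le> R / 2" using R assms(2) by linarith+
  then have "4 * (\<alpha> * c) * R \<le> (R / 2) * R" "D * D \<le> (R / 2) * (R / 2)"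
    using assms(2) \<open>0 \<le> R\<close> by (simp_all only: mult_right_mono mult_mono)
  then have "D\<^sup>2 + 4 * \<alpha> * R * c \<le> R\<^sup>2 / 4 + R\<^sup>2 / 2"
    by (simp add: power2_eq_square mult_ac)
  also have "\<dots> \<le> R\<^sup>2" using zero_le_power2[of R] by simp
  finally show "D\<^sup>2 + 4 * \<alpha> * R * (1 + 13 * s + L) \<le> R\<^sup>2" by (simp only: c_def)
  have "R\<^sup>2 \<le> 2 * (8 * (\<alpha> * c))\<^sup>2 + 2 * (2 * D)\<^sup>2"
    unfolding R using zero_le_power2[of "8 * (\<alpha> * c) - 2 * D"]
    by (simp add: power2_eq_square algebra_simps)
  also have "\<dots> = 128 * \<alpha>\<^sup>2 * c\<^sup>2 + 8 * D\<^sup>2"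
    by (simp add: power_mult_distrib)
  \<comment> \<open>The factor \<open>L \<ge> 1\<close> is put on the \<open>s\<^sup>2\<close> term
    to match the final bound, where \<open>\<alpha>\<^sup>2 * L\<close> is
    \<open>\<alpha> * \<beta>\<close>. The constant 50000 is a round number above
    \<open>128 * 338\<close>.\<close>
  also have "\<dots> \<le> 128 * \<alpha>\<^sup>2 * (8 * L\<^sup>2 + 338 * (L * s\<^sup>2)) + 8 * D\<^sup>2"
  proof -
    have "c\<^sup>2 \<le> (2 * L + 13 * s)\<^sup>2" using c by (intro power_mono) auto
    also have "\<dots> \<le> 8 * L\<^sup>2 + 338 * (1 * s\<^sup>2)"
      using zero_le_power2[of "2 * L - 13 * s"] by (simp add: power2_eq_square algebra_simps)
    also have "\<dots> \<le> 8 * L\<^sup>2 + 338 * (L * s\<^sup>2)"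
      using assms by (intro add_left_mono mult_left_mono mult_right_mono) auto
    finally show ?thesis by (intro add_right_mono mult_left_mono) auto
  qed
  also have "\<dots> = 43264 * (\<alpha>\<^sup>2 * L * s\<^sup>2) + 1024 * (\<alpha>\<^sup>2 * L\<^sup>2) + 8 * D\<^sup>2"
    by (simp add: algebra_simps)
  also have "\<dots> \<le> 50000 * (\<alpha>\<^sup>2 * L * s\<^sup>2) + 50000 * (\<alpha>\<^sup>2 * L\<^sup>2) + 50000 * D\<^sup>2"
    using assms by (intro add_mono mult_right_mono) auto
  finally show "R\<^sup>2 \<le> 50000 * (\<alpha>\<^sup>2 * L * s\<^sup>2 + \<alpha>\<^sup>2 * L\<^sup>2 + D\<^sup>2)"
    by (simp only: distrib_left)
qed

text \<open>A clipping level of at least \<open>M * T powr (1 / p)\<close> gains exactly a factor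
  \<open>T\<close> in the \<open>p\<close>-th power, which pays for the \<open>T\<close> steps. If
  \<open>M = 0\<close>, then \<open>\<sigma> = 0\<close> and both sides are 0.\<close>

lemma noise_level_le:
  fixes p \<sigma> M m :: real
  assumes "1 < p" "0 \<le> \<sigma>" "0 \<le> M" "M = 0 \<longrightarrow> \<sigma> = 0" "1 \<le> T"
    and m: "0 < m" "M * real T powr (1 / p) \<le> m"
  shows "T * (\<sigma> / m) powr p \<le> (\<sigma> / M) powr p"
proof (cases "M = 0")
  case True
  then show ?thesis using assms by simp
next
  case False
  let ?t = "real T powr (1 / p)"
  have pos: "0 < M" "0 < ?t" using False assms by auto
  have "\<sigma> / m \<le> \<sigma> / (M * ?t)"
    using pos assms by (intro divide_left_mono) auto
  then have "(\<sigma> / m) powr p \<le> (\<sigma> / M / ?t) powr p"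
    using assms by (intro powr_mono2) auto
  also have "\<dots> = (\<sigma> / M) powr p / (?t powr p)"
    by (rule powr_divide)
  also have "?t powr p = T" using assms by (simp add: powr_powr)
  finally show ?thesis using assms by (simp add: field_simps)
qed

text \<open>Whichever term attains the minimum in the step size, \<open>\<alpha> / \<eta>\<close> is
  \<open>G * sqrt T\<close> or the clipping level, and \<open>T\<close> times the rate dominates
  \<open>G * sqrt T\<close>, \<open>G\<close> and \<open>M * T powr (1 / p)\<close>. The factor 2
  comes from the \<open>2 * G\<close> in the clipping level.\<close>

lemma step_size_lower:
  fixes G M p \<alpha> :: real
  assumes "0 < G" "0 \<le> M" "1 < p" "1 \<le> T"
    and "\<alpha> = \<eta> * (G * sqrt T) \<or> \<alpha> = \<eta> * max (2 * G) (M * real T powr (1 / p))" and "0 < \<eta>"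
  shows "\<alpha> \<le> 2 * \<eta> * T * max (G / sqrt T) (M / real T powr ((p - 1) / p))"
    (is "_ \<le> 2 * \<eta> * T * ?mx")
proof -
  have sT: "sqrt T * sqrt T = T" "1 \<le> sqrt T" using assms by simp_all
  have "G * sqrt T = T * (G / sqrt T)" using sT by (simp add: field_simps)
  also have "\<dots> \<le> T * ?mx" by (intro mult_left_mono) auto
  finally have 1: "G * sqrt T \<le> T * ?mx" .
  have 2: "G \<le> T * ?mx" using 1 mult_left_mono[OF sT(2), of G] assms by linarith
  have "real T powr (1 / p) = T powr (1 - (p - 1) / p)"
    using assms by (simp add: field_simps)
  also have "\<dots> = T / T powr ((p - 1) / p)"
    using assms by (simp add: powr_diff)
  finally have "M * real T powr (1 / p) = T * (M / T powr ((p - 1) / p))" by simp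
  also have "\<dots> \<le> T * ?mx" by (intro mult_left_mono) auto
  finally have 3: "M * real T powr (1 / p) \<le> T * ?mx" .
  have "0 \<le> T * ?mx" using 2 assms by linarith
  then have "G * sqrt T \<le> 2 * (T * ?mx)" "max (2 * G) (M * real T powr (1 / p)) \<le> 2 * (T * ?mx)"
    using 1 2 3 by auto
  note le = this
  have "\<alpha> \<le> \<eta> * (2 * (T * ?mx))"
    using assms(5)
  proof
    assume "\<alpha> = \<eta> * (G * sqrt T)"
    then show ?thesis using le(1) \<open>0 < \<eta>\<close> by (simp only: mult_left_mono less_imp_le)
  next
    assume "\<alpha> = \<eta> * max (2 * G) (M * real T powr (1 / p))"
    then show ?thesis using le(2) \<open>0 < \<eta>\<close> by (simp only: mult_left_mono less_imp_le)
  qed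
  then show ?thesis by (simp only: mult.assoc mult.left_commute)
qed

section \<open>The logarithmic factor and the final bound\<close>

lemma one_le_ln_4_div:
  fixes \<delta> :: real
  assumes "0 < \<delta>" "\<delta> < 1"
  shows "1 \<le> ln (4 / \<delta>)"
proof -
  have "4 \<le> 4 / \<delta>" using assms by (simp add: field_simps)
  then have "exp 1 \<le> 4 / \<delta>" using exp_le by linarith
  then show ?thesis using assms by (simp add: ln_ge_iff)
qed

lemma le_ln_4_div_mult:
  fixes \<delta> \<beta> e :: real
  assumes "0 < \<delta>" "\<delta> < 1" "0 \<le> \<beta>" "0 \<le> e"
  shows "\<beta> \<le> ln (4 / \<delta>) * (\<beta> + e)"
  using mult_mono[OF one_le_ln_4_div[OF assms(1,2)], of \<beta> "\<beta> + e"] assms one_le_ln_4_div[OF assms(1,2)]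
  by simp

text \<open>Instantiates the stopped-sum argument with \<open>s = (\<sigma> / M) powr p\<close> and
  the radius of \<open>radius_bound\<close>. The explicit bound is only required to be below
  \<open>B\<close>, so that both claims of the theorem follow from one statement.\<close>

lemma clipped_sgd_bound:
  assumes problem: "stochastic_convex_problem d F X xs G p \<sigma> Q" and "x1 \<in> X" and T: "1 \<le> T"
    and \<delta>: "0 < \<delta>" "\<delta> < 1" and M: "0 \<le> M" "M = 0 \<longrightarrow> \<sigma> = 0" and \<beta>: "0 < \<beta>"
  defines "L \<equiv> ln (4 / \<delta>)" and "D \<equiv> enorm d (vsub x1 xs)"
    and "m \<equiv> max (2 * G) (M * real T powr (1 / p))"
    and "rate \<equiv> max (G / sqrt (real T)) (M / real T powr ((p - 1) / p))"
  defines "\<eta> \<equiv> min (\<beta> / L / (G * sqrt (real T))) (\<beta> / L / m)"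
  assumes B: "50000 * (\<beta> * (\<sigma> / M) powr (2 * p) + L * (\<beta> + D\<^sup>2 / \<beta>)) * rate \<le> B"
  defines "P \<equiv> answers_law d X Q (\<lambda>_. m) (\<lambda>_. \<eta>) x1 T"
  shows "1 - \<delta> \<le> measure P
    {\<omega> \<in> space P. F (average_iterate d X (\<lambda>_. m) (\<lambda>_. \<eta>) x1 T \<omega>) - F xs \<le> ereal B}"
proof -
  interpret stochastic_convex_problem d F X xs G p \<sigma> Q by (rule problem)
  define \<alpha> where "\<alpha> = \<beta> / L"
  define s where "s = (\<sigma> / M) powr p"
  define R where "R = 8 * \<alpha> * (1 + 13 * s + L) + 2 * D"
  have L: "1 \<le> L" unfolding L_def using \<delta> by (rule one_le_ln_4_div)
  have \<alpha>: "0 < \<alpha>" and \<beta>_eq: "\<beta> = \<alpha> * L" using L \<beta> by (simp_all add: \<alpha>_def)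
  have s: "0 \<le> s" and D: "0 \<le> D" by (simp_all add: s_def D_def)
  have m: "2 * G \<le> m" "0 < m" "M * real T powr (1 / p) \<le> m" using G_pos by (auto simp: m_def)
  have GT: "0 < G * sqrt T" using G_pos T by simp
  have \<eta>: "0 < \<eta>" "\<eta> * (G * sqrt T) \<le> \<alpha>" "\<eta> * m \<le> \<alpha>"
    "\<alpha> = \<eta> * (G * sqrt T) \<or> \<alpha> = \<eta> * m"
  proof -
    have min_eq: "\<eta> = min (\<alpha> / (G * sqrt T)) (\<alpha> / m)" by (simp only: \<eta>_def \<alpha>_def)
    show "0 < \<eta>" using \<alpha> GT m(2) by (simp only: min_eq min_less_iff_conj divide_pos_pos)
    have "\<eta> \<le> \<alpha> / (G * sqrt T)" "\<eta> \<le> \<alpha> / m" by (simp_all only: min_eq min.cobounded1 min.cobounded2)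
    then show "\<eta> * (G * sqrt T) \<le> \<alpha>" "\<eta> * m \<le> \<alpha>"
      using GT m(2) by (simp_all only: pos_le_divide_eq)
    have "\<eta> = \<alpha> / (G * sqrt T) \<or> \<eta> = \<alpha> / m" by (simp only: min_eq min_def split: if_split) blast
    then show "\<alpha> = \<eta> * (G * sqrt T) \<or> \<alpha> = \<eta> * m"
      using GT m(2) by (metis less_irrefl nonzero_eq_divide_eq)
  qed
  note R_bounds = radius_bound[OF \<alpha> D L s, folded R_def]
  interpret sgd: clipped_sgd d F X xs G p \<sigma> Q x1 T m \<eta> \<alpha> s R
  proof (intro clipped_sgd.intro[OF problem] clipped_sgd_axioms.intro)
    show "T * (\<sigma> / m) powr p \<le> s"
      unfolding s_def by (rule noise_level_le[OF p_range(1) sigma_nonneg M T m(2,3)])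
    show "\<eta> * G * sqrt T \<le> \<alpha>" using \<eta>(2) by (simp only: mult.assoc)
  qed (fact | fact m(1) R_bounds(1))+
  have radius: "(enorm d (vsub x1 xs))\<^sup>2 + 4 * \<alpha> * R * (1 + 13 * s + ln (1 / \<delta>)) \<le> R\<^sup>2"
  proof -
    have "ln (1 / \<delta>) \<le> L" using \<delta> by (simp add: L_def field_simps)
    then have "4 * \<alpha> * R * (1 + 13 * s + ln (1 / \<delta>)) \<le> 4 * \<alpha> * R * (1 + 13 * s + L)"
      using \<alpha> R_bounds(1) by (intro mult_left_mono) auto
    then show ?thesis using R_bounds(2) unfolding D_def by linarith
  qed
  let ?E = "\<beta> * (\<sigma> / M) powr (2 * p) + L * (\<beta> + D\<^sup>2 / \<beta>)"
  have "(\<sigma> / M) powr (2 * p) = s\<^sup>2"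
    unfolding s_def power2_eq_square mult_2 by (rule powr_add)
  \<comment> \<open>Since \<open>\<beta> = \<alpha> * L\<close>, multiplying the bracket of the
    theorem by \<open>\<alpha>\<close> produces exactly the three terms of
    \<open>radius_bound\<close>; \<open>step_size_lower\<close> then replaces this
    \<open>\<alpha>\<close> by \<open>2 * \<eta> * T * rate\<close>.\<close>
  then have E: "?E * \<alpha> = \<alpha>\<^sup>2 * L * s\<^sup>2 + \<alpha>\<^sup>2 * L\<^sup>2 + D\<^sup>2"
  proof -
    have "L * (D\<^sup>2 / \<beta>) * \<alpha> = D\<^sup>2" using \<alpha> L by (simp add: \<beta>_eq)
    moreover have "(\<beta> * t + L * (\<beta> + e)) * \<alpha> = \<alpha>\<^sup>2 * L * t + \<alpha>\<^sup>2 * L\<^sup>2 + L * e * \<alpha>" for t e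
      by (simp add: \<beta>_eq algebra_simps power2_eq_square)
    ultimately show ?thesis using \<open>(\<sigma> / M) powr (2 * p) = s\<^sup>2\<close> by simp
  qed
  have E0: "0 \<le> ?E" using \<beta> L by auto
  have "R\<^sup>2 \<le> 50000 * ?E * \<alpha>"
    using R_bounds(3) E by (simp only: mult.assoc)
  also have "\<dots> \<le> 50000 * ?E * (2 * \<eta> * T * rate)"
    using E0 step_size_lower[OF G_pos M(1) p_range(1) T \<eta>(4)[unfolded m_def] \<eta>(1)]
    unfolding rate_def by (intro mult_left_mono) auto
  also have "\<dots> = 2 * \<eta> * T * (50000 * ?E * rate)" by simp
  also have "\<dots> \<le> 2 * \<eta> * T * B" using B \<eta>(1) by (intro mult_left_mono) auto
  finally have "R\<^sup>2 \<le> 2 * \<eta> * T * B" .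
  from sgd.suboptimality_high_probability[OF \<delta>(1) less_imp_le[OF \<delta>(2)] radius this]
  show ?thesis by (simp only: P_def answers_law_def)
qed

theorem theorem3:
  shows "\<exists>C::real. C > 0 \<and>
    (\<forall>(d::nat) F X xs G p \<sigma> Q x1 (T::nat) \<delta> M \<beta>.
       stochastic_convex_problem d F X xs G p \<sigma> Q \<and> x1 \<in> X \<and> T \<ge> 1 \<and>
       0 < \<delta> \<and> \<delta> < 1 \<and> M \<ge> 0 \<and> \<beta> > 0 \<longrightarrow>
       (let \<alpha> = \<beta> / ln (4 / \<delta>);
            m = (\<lambda>t::nat. max (2 * G) (M * real T powr (1 / p)));
            \<eta> = (\<lambda>t::nat. min (\<alpha> / (G * sqrt (real T))) (\<alpha> / m t));
            P = answers_law d X Q m \<eta> x1 T;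
            xbar = average_iterate d X m \<eta> x1 T
        in
         ((M = 0 \<longrightarrow> \<sigma> = 0) \<longrightarrow>
            measure P {\<omega> \<in> space P. F (xbar \<omega>) - F xs \<le>
              ereal (C * (\<beta> * (\<sigma> / M) powr (2 * p) +
                          ln (4 / \<delta>) * (\<beta> + (enorm d (vsub x1 xs))\<^sup>2 / \<beta>)) *
                     max (G / sqrt (real T)) (M / real T powr ((p - 1) / p)))} \<ge> 1 - \<delta>) \<and>
         (M = \<sigma> \<longrightarrow>
            measure P {\<omega> \<in> space P. F (xbar \<omega>) - F xs \<le>
              ereal (C * ln (4 / \<delta>) * (\<beta> + (enorm d (vsub x1 xs))\<^sup>2 / \<beta>) *
                     max (G / sqrt (real T)) (\<sigma> / real T powr ((p - 1) / p)))} \<ge> 1 - \<delta>)))"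
  unfolding Let_def
\<comment> \<open>The constant is twice 50000: in the second claim the noise term is absorbed into
  the other one, which doubles it.\<close>
proof (intro exI[of _ 100000] conjI allI impI, goal_cases)
  case (2 d F X xs G p \<sigma> Q x1 T \<delta> M \<beta>)
  then interpret stochastic_convex_problem d F X xs G p \<sigma> Q by blast
  let ?E = "\<beta> * (\<sigma> / M) powr (2 * p)"
    and ?V = "ln (4 / \<delta>) * (\<beta> + (enorm d (vsub x1 xs))\<^sup>2 / \<beta>)"
    and ?rate = "max (G / sqrt (real T)) (M / real T powr ((p - 1) / p))"
  have "\<beta> \<le> ?V" using 2 by (intro le_ln_4_div_mult) auto
  then have "0 \<le> ?E + ?V" using 2 by (intro add_nonneg_nonneg) auto
  moreover have "0 \<le> ?rate" using G_pos by (simp add: le_max_iff_disj)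
  ultimately have "50000 * (?E + ?V) * ?rate \<le> 100000 * (?E + ?V) * ?rate"
    by (intro mult_right_mono) auto
  with 2 show ?case by (intro clipped_sgd_bound) auto
next
  case (3 d F X xs G p \<sigma> Q x1 T \<delta> M \<beta>)
  then interpret stochastic_convex_problem d F X xs G p \<sigma> Q by blast
  let ?E = "\<beta> * (\<sigma> / M) powr (2 * p)"
    and ?V = "ln (4 / \<delta>) * (\<beta> + (enorm d (vsub x1 xs))\<^sup>2 / \<beta>)"
    and ?rate = "max (G / sqrt (real T)) (\<sigma> / real T powr ((p - 1) / p))"
  have "\<beta> \<le> ?V" using 3 by (intro le_ln_4_div_mult) auto
  \<comment> \<open>With \<open>M = \<sigma>\<close> the quotient \<open>\<sigma> / M\<close> is 1,
    or 0 when both vanish.\<close>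
  moreover have "?E \<le> \<beta>" using 3 by (cases "\<sigma> = 0") auto
  ultimately have "50000 * (?E + ?V) \<le> 100000 * ?V" by argo
  moreover have "0 \<le> ?rate" using G_pos by (simp add: le_max_iff_disj)
  ultimately have "50000 * (?E + ?V) * ?rate \<le> 100000 * ?V * ?rate"
    by (rule mult_right_mono)
  with 3 show ?case by (intro clipped_sgd_bound) (auto simp: mult.assoc)
qed simp

end
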